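(* For $\hat\nu\in\mathcal M(\widehat Y)$ define the measure $\Phi(\hat\nu)$ on $Y$ by $$\Phi(\hat\nu):=Z_{\hat\nu}^{-1}\sum_{s\in\mathcal S}\sum_{j=0}^{k(s)-1}\phi_{sj*}\hat\nu_s .$$ Then $\Phi$ is a bijection of $\mathcal M(\widehat Y)$ with $\mathcal M(Y)$, and for $\nu\in\mathcal M(Y)$, $\Phi^{-1}(\nu)=\widetilde Z_\nu^{-1}\sum_{s\in\mathcal S}(\phi_{s0}^{-1})_*\nu_s$, where $\widetilde Z_\nu=\sum_{s\in\mathcal S}\nu(Y_s)$. $\Phi(\hat\nu)$ is ergodic (under translations) if and only if $\hat\nu$ is.
   Context: $\mathcal S$ and $\mathcal T$ are countable alphabets, $\widehat Y=\mathcal S^{\mathbb Z}$, $Y=\mathcal T^{\mathbb Z}$. For each $s\in\mathcal S$ a finite (nonempty) word $\chi(s)=t_s(1)\dots t_s(k(s))$ in the alphabet $\mathcal T$ is given. The substitution map $\phi:\widehat Y\to Y$ is $\phi(\dots\zeta(-1)\zeta(0)\zeta(1)\dots)=\dots\chi(\zeta(-1))\chi(\zeta(0))\chi(\zeta(1))\dots$ (concatenation), with $\chi(\zeta(1))$ beginning at site 1. Translation: $(\tau\eta)(i)=\eta(i-1)$. For $s\in\mathcal S$: $\widehat Y_s=\{\zeta\in\widehat Y:\zeta(1)=s\}$, $Y_s=\phi(\widehat Y_s)$; for $0\le j\le k(s)-1$: $Y_{sj}=\tau^{-j}Y_s$ and $\phi_{sj}:\widehat Y_s\to Y_{sj}$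 is $\phi_{sj}=\tau^{-j}\phi|_{\widehat Y_s}$. Standing assumption: the sets $Y_{sj}$ ($s\in\mathcal S$, $0\le j\le k(s)-1$) are pairwise disjoint. A translation invariant (TI) probability measure $\hat\nu$ on $\widehat Y$ is regular if $Z_{\hat\nu}:=\sum_{s\in\mathcal S}k(s)\hat\nu(\widehat Y_s)<\infty$; a TI probability measure $\nu$ on $Y$ is regular if it is supported on $\bigcup_{s\in\mathcal S}\bigcup_{j=0}^{k(s)-1}Y_{sj}$. $\mathcal M(\widehat Y)$, $\mathcal M(Y)$ are the sets of regular TI probability measures on $\widehat Y$, $Y$. $\hat\nu_s=\hat\nu|_{\widehat Y_s}$ and $\nu_s=\nu|_{Y_s}$ are restrictions, and $f_*$ denotes push-forward of measures. *)

theory Defs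
  imports "HOL-Probability.Probability"
begin

text \<open>An alphabet is a type of class \<open>countable\<close> (finite or countably infinite), and the family of words
  is a function \<open>w\<close> into lists.  A configuration is a function on \<open>int\<close>.\<close>

text \<open>\<open>block_start w \<zeta> n\<close> is the site at which the word \<open>w (\<zeta> n)\<close> begins in the concatenation, normalized
  so that \<open>w (\<zeta> 1)\<close> begins at site 1.  For \<open>n \<ge> 1\<close> the second sum is empty, for \<open>n \<le> 1\<close> the first one.\<close>

definition block_start :: "('s \<Rightarrow> 't list) \<Rightarrow> (int \<Rightarrow> 's) \<Rightarrow> int \<Rightarrow> int" where
  "block_start w \<zeta> n =
     1 + (\<Sum>m\<in>{1..<n}. int (length (w (\<zeta> m)))) - (\<Sum>m\<in>{n..<1}. int (length (w (\<zeta> m))))"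

text \<open>List positions count from 0, so the letter \<open>t\<^sub>s(j + 1)\<close> of the word of \<open>s\<close> is \<open>w s ! j\<close>.\<close>

definition subst_map :: "('s \<Rightarrow> 't list) \<Rightarrow> (int \<Rightarrow> 's) \<Rightarrow> (int \<Rightarrow> 't)" where
  "subst_map w \<zeta> i =
     (let n = (THE n. block_start w \<zeta> n \<le> i \<and> i < block_start w \<zeta> (n + 1))
      in w (\<zeta> n) ! nat (i - block_start w \<zeta> n))"

lemma block_start_1 [simp]: "block_start w \<zeta> 1 = 1"
  by (simp add: block_start_def)

lemma block_start_Suc: "block_start w \<zeta> (n + 1) = block_start w \<zeta> n + int (length (w (\<zeta> n)))"
proof (cases "n \<ge> 1")
  case True
  then have "{1..<n + 1} = insert n {1..<n}" by auto
  with True show ?thesis by (simp add: block_start_def)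
next
  case False
  then have "{n..<1} = insert n {n + 1..<1}" by auto
  with False show ?thesis by (simp add: block_start_def)
qed

lemma block_start_mono:
  assumes "m \<le> n"
  shows "block_start w \<zeta> m \<le> block_start w \<zeta> n"
  using assms
proof (induction n rule: int_ge_induct)
  case (step i)
  then show ?case by (simp add: block_start_Suc)
qed simp

lemma subst_map_block:
  assumes "j < length (w (\<zeta> n))"
  shows "subst_map w \<zeta> (block_start w \<zeta> n + int j) = w (\<zeta> n) ! j"
proof -
  have *: "(THE m. block_start w \<zeta> m \<le> block_start w \<zeta> n + int j \<and>
             block_start w \<zeta> n + int j < block_start w \<zeta> (m + 1)) = n"
  proof (rule the_equality)
    show "block_start w \<zeta> n \<le> block_start w \<zeta> n + int j \<and>
          block_start w \<zeta> n + int j < block_start w \<zeta> (n + 1)"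
      using assms by (simp add: block_start_Suc)
  next
    fix m assume m: "block_start w \<zeta> m \<le> block_start w \<zeta> n + int j \<and>
          block_start w \<zeta> n + int j < block_start w \<zeta> (m + 1)"
    have "\<not> m + 1 \<le> n" using block_start_mono[of "m + 1" n w \<zeta>] m by linarith
    moreover have "\<not> n + 1 \<le> m"
      using block_start_mono[of "n + 1" m w \<zeta>] block_start_Suc[of w \<zeta> n] m assms by linarith
    ultimately show "m = n" by linarith
  qed
  show ?thesis by (simp add: subst_map_def *)
qed

text \<open>If no word is empty, every site lies in a block, so \<open>subst_map_block\<close> determines \<open>subst_map\<close>.\<close>

lemma block_exists:
  assumes ne: "\<And>s. w s \<noteq> []"
  shows "\<exists>n j. j < length (w (\<zeta> n)) \<and> i = block_start w \<zeta> n + int j"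
proof -
  have next_block: "block_start w \<zeta> n + 1 \<le> block_start w \<zeta> (n + 1)" for n
  proof -
    have "length (w (\<zeta> n)) > 0" using ne by simp
    then show ?thesis using block_start_Suc[of w \<zeta> n] by linarith
  qed
  have up: "n \<le> block_start w \<zeta> n" if "1 \<le> n" for n
    using that
  proof (induction n rule: int_ge_induct)
    case (step k)
    then show ?case using next_block[of k] by linarith
  qed simp
  have down: "block_start w \<zeta> n \<le> n" if "n \<le> 1" for n
    using that
  proof (induction n rule: int_le_induct)
    case (step k)
    then show ?case using next_block[of "k - 1"] by simp
  qed simp
  define a where "a = min i 1"
  have a: "block_start w \<zeta> a \<le> i" using down[of a] by (simp add: a_def)
  have "\<exists>n. block_start w \<zeta> n \<le> i \<and> i < block_start w \<zeta> (n + 1)"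
  proof (rule ccontr)
    assume no: "\<not> ?thesis"
    have "block_start w \<zeta> n \<le> i" if "a \<le> n" for n
      using that
    proof (induction n rule: int_ge_induct)
      case base
      show ?case by (rule a)
    next
      case (step k)
      with no show ?case by (meson not_less)
    qed
    moreover have "a \<le> max (i + 1) 1" by (simp add: a_def)
    ultimately have "block_start w \<zeta> (max (i + 1) 1) \<le> i" by blast
    with up[of "max (i + 1) 1"] show False by simp
  qed
  then obtain n where n: "block_start w \<zeta> n \<le> i" "i < block_start w \<zeta> (n + 1)" by blast
  then show ?thesis
    by (intro exI[of _ n] exI[of _ "nat (i - block_start w \<zeta> n)"])
       (simp add: block_start_Suc nat_less_iff)
qed

text \<open>\<open>translate n\<close> is the power \<open>\<tau>\<^sup>n\<close>, for \<open>n\<close> positive or negative.\<close>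

definition translate :: "int \<Rightarrow> (int \<Rightarrow> 'a) \<Rightarrow> (int \<Rightarrow> 'a)" where
  "translate n \<eta> = (\<lambda>i. \<eta> (i - n))"

lemma translate_0: "translate 0 = id"
  by (simp add: translate_def fun_eq_iff)

lemma translate_add: "translate (m + n) = translate m \<circ> translate n"
  by (simp add: translate_def fun_eq_iff algebra_simps)

definition Yhat_sub :: "'s \<Rightarrow> (int \<Rightarrow> 's) set" where
  "Yhat_sub s = {\<zeta>. \<zeta> 1 = s}"

definition Y_sub :: "('s \<Rightarrow> 't list) \<Rightarrow> 's \<Rightarrow> (int \<Rightarrow> 't) set" where
  "Y_sub w s = subst_map w ` Yhat_sub s"

definition Y_shift :: "('s \<Rightarrow> 't list) \<Rightarrow> 's \<Rightarrow> nat \<Rightarrow> (int \<Rightarrow> 't) set" where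
  "Y_shift w s j = translate (- int j) ` Y_sub w s"

text \<open>As a total function, \<open>\<phi>\<^sub>s\<^sub>j\<close> does not depend on \<open>s\<close>; only its domain \<open>Yhat_sub s\<close> does.\<close>

definition phi_shift :: "('s \<Rightarrow> 't list) \<Rightarrow> nat \<Rightarrow> (int \<Rightarrow> 's) \<Rightarrow> (int \<Rightarrow> 't)" where
  "phi_shift w j = translate (- int j) \<circ> subst_map w"

text \<open>The product \<open>\<sigma>\<close>-algebra of the discrete ones; for countable alphabets it is the Borel \<open>\<sigma>\<close>-algebra.
  Only the \<open>\<sigma>\<close>-algebra of \<open>config_space\<close> is used.\<close>

definition config_space :: "(int \<Rightarrow> 'a) measure" where
  "config_space = (\<Pi>\<^sub>M i\<in>UNIV. count_space UNIV)"

lemma space_config_space [simp]: "space config_space = UNIV"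
  by (simp add: config_space_def space_PiM PiE_UNIV_domain)

definition TI_prob :: "(int \<Rightarrow> 'a) measure \<Rightarrow> bool" where
  "TI_prob \<nu> \<longleftrightarrow> prob_space \<nu> \<and> sets \<nu> = sets config_space \<and> distr \<nu> config_space (translate 1) = \<nu>"

definition ergodic :: "(int \<Rightarrow> 'a) measure \<Rightarrow> bool" where
  "ergodic \<nu> \<longleftrightarrow> TI_prob \<nu> \<and>
     (\<forall>A\<in>sets \<nu>. translate 1 -` A = A \<longrightarrow> emeasure \<nu> A = 0 \<or> emeasure \<nu> A = 1)"

text \<open>Sums of nonnegative terms over the alphabet are integrals with respect to counting measure,
  with values in \<open>ennreal\<close>.\<close>

definition Z_hat :: "('s \<Rightarrow> 't list) \<Rightarrow> (int \<Rightarrow> 's) measure \<Rightarrow> ennreal" where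
  "Z_hat w \<nu> = (\<integral>\<^sup>+s. of_nat (length (w s)) * emeasure \<nu> (Yhat_sub s) \<partial>count_space UNIV)"

definition Z_tilde :: "('s \<Rightarrow> 't list) \<Rightarrow> (int \<Rightarrow> 't) measure \<Rightarrow> ennreal" where
  "Z_tilde w \<nu> = (\<integral>\<^sup>+s. emeasure \<nu> (Y_sub w s) \<partial>count_space UNIV)"

definition M_hat :: "('s \<Rightarrow> 't list) \<Rightarrow> (int \<Rightarrow> 's) measure set" where
  "M_hat w = {\<nu>. TI_prob \<nu> \<and> Z_hat w \<nu> < \<infinity>}"

text \<open>\<open>AE\<close>, \<open>Z_tilde\<close> and \<open>Phi_inverse\<close> do not presuppose that the sets \<open>Y_sub w s\<close> are measurable,
  but \<open>emeasure\<close> and \<open>restrict_space\<close> have the intended meaning only when they are.  For countable alphabets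
  and pairwise disjoint sets \<open>Y_shift w s j\<close> this holds by the Lusin-Souslin theorem: \<open>subst_map w\<close> is then
  continuous and injective on \<open>Yhat_sub s\<close>.\<close>

definition M_reg :: "('s \<Rightarrow> 't list) \<Rightarrow> (int \<Rightarrow> 't) measure set" where
  "M_reg w = {\<nu>. TI_prob \<nu> \<and> (AE \<eta> in \<nu>. \<eta> \<in> (\<Union>s. \<Union>j<length (w s). Y_shift w s j))}"

definition sum_measure :: "'a measure \<Rightarrow> 'i set \<Rightarrow> ('i \<Rightarrow> 'a measure) \<Rightarrow> 'a measure" where
  "sum_measure N I \<mu> =
     measure_of (space N) (sets N) (\<lambda>A. \<integral>\<^sup>+i. emeasure (\<mu> i) A \<partial>count_space I)"

lemma space_sum_measure [simp]: "space (sum_measure N I \<mu>) = space N"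
  and sets_sum_measure [simp]: "sets (sum_measure N I \<mu>) = sets N"
  by (simp_all add: sum_measure_def)

lemma emeasure_sum_measure:
  fixes N :: "'a measure" and \<mu> :: "'i \<Rightarrow> 'a measure"
  assumes sets: "\<And>i. i \<in> I \<Longrightarrow> sets (\<mu> i) = sets N" and A: "A \<in> sets N"
  shows "emeasure (sum_measure N I \<mu>) A = (\<integral>\<^sup>+i. emeasure (\<mu> i) A \<partial>count_space I)"
  unfolding sum_measure_def
proof (rule emeasure_measure_of_sigma)
  show "sigma_algebra (space N) (sets N)" by (rule sets.sigma_algebra_axioms)
  show "positive (sets N) (\<lambda>A. \<integral>\<^sup>+i. emeasure (\<mu> i) A \<partial>count_space I)"
    by (simp add: positive_def)
  show "countably_additive (sets N) (\<lambda>A. \<integral>\<^sup>+i. emeasure (\<mu> i) A \<partial>count_space I)"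
  proof (rule countably_additiveI)
    fix B :: "nat \<Rightarrow> 'a set"
    assume B: "range B \<subseteq> sets N" "disjoint_family B"
    have "(\<Sum>n. \<integral>\<^sup>+i. emeasure (\<mu> i) (B n) \<partial>count_space I) =
          (\<integral>\<^sup>+i. (\<Sum>n. emeasure (\<mu> i) (B n)) \<partial>count_space I)"
      by (rule nn_integral_suminf[symmetric]) simp
    also have "\<dots> = (\<integral>\<^sup>+i. emeasure (\<mu> i) (\<Union>n. B n) \<partial>count_space I)"
      by (rule nn_integral_cong) (use B sets in \<open>simp add: suminf_emeasure\<close>)
    finally show "(\<Sum>n. \<integral>\<^sup>+i. emeasure (\<mu> i) (B n) \<partial>count_space I) =
                  (\<integral>\<^sup>+i. emeasure (\<mu> i) (\<Union>n. B n) \<partial>count_space I)" .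
  qed
qed (fact A)

definition Phi :: "('s \<Rightarrow> 't list) \<Rightarrow> (int \<Rightarrow> 's) measure \<Rightarrow> (int \<Rightarrow> 't) measure" where
  "Phi w \<nu> = scale_measure (inverse (Z_hat w \<nu>))
     (sum_measure config_space UNIV (\<lambda>s. sum_measure config_space {..<length (w s)}
        (\<lambda>j. distr (restrict_space \<nu> (Yhat_sub s)) config_space (phi_shift w j))))"

definition Phi_inverse :: "('s \<Rightarrow> 't list) \<Rightarrow> (int \<Rightarrow> 't) measure \<Rightarrow> (int \<Rightarrow> 's) measure" where
  "Phi_inverse w \<nu> = scale_measure (inverse (Z_tilde w \<nu>))
     (sum_measure config_space UNIV
        (\<lambda>s. distr (restrict_space \<nu> (Y_sub w s)) config_space
               (inv_into (Yhat_sub s) (phi_shift w 0))))"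

end

theory Submission
  imports Defs
begin

text \<open>The index pair \<open>(s, j)\<close> with \<open>\<phi>(\<zeta>) \<in> Y\<^sub>s\<^sub>j\<close> reveals \<open>\<zeta>(1)\<close>, and the one with
  \<open>\<tau> \<phi>(\<zeta>) \<in> Y\<^sub>s\<^sub>j\<close>, which sits at the end of the preceding block, reveals \<open>\<zeta>(0)\<close>.  Hence disjointness
  makes \<open>\<phi>\<close> injective, and by Lusin--Souslin it maps measurable sets to measurable sets.
  So the union of the \<open>Y\<^sub>s\<^sub>j\<close> is the tower of height \<open>k(\<zeta>(1))\<close> over the
  base \<open>\<phi>(\<zeta>)\<close>, on which \<open>\<tau>\<^sup>-\<^sup>1\<close> climbs one level or passes from the top to the base point of
  \<open>\<tau>\<^sup>-\<^sup>1 \<zeta>\<close>.  Up to the factor \<open>Z\<close>, \<open>\<Phi>(\<nu>)(A)\<close> integrates the number of levels lying in \<open>A\<close>, and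
  \<open>\<Phi>\<^sup>-\<^sup>1\<close> is normalized restriction to the base.  For invariant \<open>A\<close> all levels agree, so \<open>A\<close> and
  \<open>\<phi>\<^sup>-\<^sup>1(A)\<close> are null together, and every invariant set of configurations \<open>\<zeta>\<close> is such a preimage.\<close>

section \<open>Cylinders and the Lusin--Souslin theorem\<close>

text \<open>Basic clopen sets of the product topology. The symmetric windows make them balls of an
  ultrametric: every point of a cylinder is a centre (\<open>cyl_eq\<close>), so two cylinders of
  the same level coincide or are disjoint.\<close>

definition cyl :: "nat \<Rightarrow> (int \<Rightarrow> 'a) \<Rightarrow> (int \<Rightarrow> 'a) set" where
  "cyl n \<zeta> = {\<xi>. \<forall>i. \<bar>i\<bar> < int n \<longrightarrow> \<xi> i = \<zeta> i}"

lemma cyl_self [simp]: "\<zeta> \<in> cyl n \<zeta>"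
  by (simp add: cyl_def)

lemma cyl_0 [simp]: "cyl 0 \<zeta> = UNIV"
  by (simp add: cyl_def)

lemma cyl_eq: "\<xi> \<in> cyl n \<zeta> \<Longrightarrow> cyl n \<xi> = cyl n \<zeta>"
  by (auto simp: cyl_def)

lemma cyl_antimono: "m \<le> n \<Longrightarrow> cyl n \<zeta> \<subseteq> cyl m \<zeta>"
  by (auto simp: cyl_def)

lemma countable_range_cyl: "countable (range (cyl n :: (int \<Rightarrow> 'a::countable) \<Rightarrow> _))"
proof -
  \<comment> \<open>A cylinder is coded by the finite word on its window, and there are countably
    many words.\<close>
  have *: "cyl n \<zeta> = {\<xi>. map \<xi> [1 - int n..int n - 1] = map \<zeta> [1 - int n..int n - 1]}" for \<zeta> :: "int \<Rightarrow> 'a"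
    by (auto simp: cyl_def abs_less_iff)
  have "range (cyl n :: (int \<Rightarrow> 'a) \<Rightarrow> _) \<subseteq>
      range (\<lambda>l :: 'a list. {\<xi>. map \<xi> [1 - int n..int n - 1] = l})"
    unfolding * by blast
  then show ?thesis
    by (rule countable_subset) simp
qed

lemma UNIV_in_sets [simp]: "UNIV \<in> sets config_space"
  using sets.top[of config_space] by simp

lemma coordinate_in_sets [measurable]: "{\<eta>. \<eta> i = a} \<in> sets config_space"
proof -
  have "(\<lambda>\<eta>. \<eta> i) \<in> measurable config_space (count_space UNIV)"
    unfolding config_space_def by measurable
  from measurable_sets[OF this, of "{a}"] show ?thesis
    by (simp add: vimage_def)
qed

lemma cyl_in_sets [measurable]: "cyl n \<zeta> \<in> sets config_space"
proof -
  have "cyl n \<zeta> = (\<Inter>i. if \<bar>i\<bar> < int n then {\<eta>. \<eta> i = \<zeta> i} else space config_space)"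
    by (auto simp: cyl_def)
  also have "\<dots> \<in> sets config_space"
    by (intro sets.countable_INT'') auto
  finally show ?thesis .
qed

text \<open>The hypothesis is openness. Over a countable alphabet there are only countably many
  cylinders, so the union of those inside \<open>A\<close> is a countable one.\<close>

lemma open_in_sets:
  fixes A :: "(int \<Rightarrow> 'a::countable) set"
  assumes "\<And>\<zeta>. \<zeta> \<in> A \<Longrightarrow> \<exists>n. cyl n \<zeta> \<subseteq> A"
  shows "A \<in> sets config_space"
proof -
  define D where "D = {c \<in> (\<Union>n. range (cyl n)). c \<subseteq> A}"
  have "\<Union> D \<in> sets config_space"
  proof (rule sets.countable_Union)
    show "countable D"
      unfolding D_def by (intro countable_Collect) (auto intro: countable_range_cyl)
    show "D \<subseteq> sets config_space"
      unfolding D_def using cyl_in_sets by blast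
  qed
  also have "\<Union> D = A"
  proof (intro equalityI subsetI)
    fix \<zeta> assume "\<zeta> \<in> A"
    then obtain n where "cyl n \<zeta> \<subseteq> A"
      using assms by blast
    then show "\<zeta> \<in> \<Union> D"
      unfolding D_def by (intro UnionI[of "cyl n \<zeta>"]) auto
  qed (auto simp: D_def)
  finally show ?thesis .
qed

lemma measurable_config_spaceI:
  fixes f :: "'b \<Rightarrow> int \<Rightarrow> 'a::countable"
  assumes "\<And>i a. {x \<in> space M. f x i = a} \<in> sets M"
  shows "f \<in> measurable M config_space"
  unfolding config_space_def
proof (rule measurable_PiM_single')
  fix i
  have "(\<lambda>x. f x i) -` {a} \<inter> space M = {x \<in> space M. f x i = a}" for a
    by auto
  then show "(\<lambda>x. f x i) \<in> measurable M (count_space UNIV)"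
    using assms[of i] by (simp add: measurable_count_space_eq2_countable)
qed (simp add: PiE_UNIV_domain)

text \<open>Continuity for products of discrete spaces: each output coordinate is locally
  constant.\<close>

definition cylinder_continuous :: "((int \<Rightarrow> 'a) \<Rightarrow> (int \<Rightarrow> 'b)) \<Rightarrow> bool" where
  "cylinder_continuous f \<longleftrightarrow> (\<forall>\<zeta> i. \<exists>n. \<forall>\<xi>\<in>cyl n \<zeta>. f \<xi> i = f \<zeta> i)"

lemma cylinder_continuousD: "cylinder_continuous f \<Longrightarrow> \<exists>n. \<forall>\<xi>\<in>cyl n \<zeta>. f \<xi> i = f \<zeta> i"
  by (simp add: cylinder_continuous_def)

lemma cylinder_continuous_measurable:
  fixes f :: "(int \<Rightarrow> 'a::countable) \<Rightarrow> (int \<Rightarrow> 'b::countable)"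
  assumes "cylinder_continuous f"
  shows "f \<in> measurable config_space config_space"
proof (rule measurable_config_spaceI)
  fix i a
  show "{\<zeta> \<in> space config_space. f \<zeta> i = a} \<in> sets config_space"
    using assms by (intro open_in_sets) (force simp: cylinder_continuous_def)
qed

section \<open>Lusin's separation of disjoint images\<close>

lemma cylinder_limit:
  assumes "\<And>m n. m \<le> n \<Longrightarrow> a n \<in> cyl m (a m)"
  obtains x where "\<And>n. x \<in> cyl n (a n)"
proof
  fix n
  \<comment> \<open>Completeness: site \<open>i\<close> lies in the window of level
    \<open>nat \<bar>i\<bar> + 1\<close>, so all later \<open>a n\<close> agree there and the limit
    can read its value at that index.\<close>
  show "(\<lambda>i. a (nat \<bar>i\<bar> + 1) i) \<in> cyl n (a n)"
    unfolding cyl_def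
  proof safe
    fix i :: int
    assume "\<bar>i\<bar> < int n"
    then have "a n \<in> cyl (nat \<bar>i\<bar> + 1) (a (nat \<bar>i\<bar> + 1))"
      by (intro assms) auto
    then show "a (nat \<bar>i\<bar> + 1) i = a n i"
      by (simp add: cyl_def)
  qed
qed

definition separable_sets :: "(int \<Rightarrow> 'a) set \<Rightarrow> (int \<Rightarrow> 'a) set \<Rightarrow> bool" where
  "separable_sets P Q \<longleftrightarrow> (\<exists>B\<in>sets config_space. P \<subseteq> B \<and> Q \<inter> B = {})"

text \<open>If \<open>B i j\<close> separates each pair, the union over \<open>i\<close> of the
  intersections over \<open>j\<close> separates the unions. Contrapositively, an inseparable pair of
  countable unions contains an inseparable pair of pieces.\<close>

lemma separable_sets_UN:
  assumes I: "countable I" and J: "countable J"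
    and sep: "\<And>i j. i \<in> I \<Longrightarrow> j \<in> J \<Longrightarrow> separable_sets (P i) (Q j)"
  shows "separable_sets (\<Union>i\<in>I. P i) (\<Union>j\<in>J. Q j)"
proof -
  obtain B where B: "\<And>i j. i \<in> I \<Longrightarrow> j \<in> J \<Longrightarrow>
      B i j \<in> sets config_space \<and> P i \<subseteq> B i j \<and> Q j \<inter> B i j = {}"
    using sep unfolding separable_sets_def by metis
  show ?thesis
    unfolding separable_sets_def
  proof (intro bexI conjI)
    have "(\<Union>j\<in>J. space config_space - B i j) \<in> sets config_space" if "i \<in> I" for i
      by (rule sets.countable_UN'[OF J]) (use B that in blast)
    then show "(\<Union>i\<in>I. space config_space - (\<Union>j\<in>J. space config_space - B i j)) \<in> sets config_space"
      by (intro sets.countable_UN'[OF I]) blast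
  qed (use B in fastforce)+
qed

text \<open>Lusin's separation argument: two images that cannot be separated contain, at every finer level,
  images of smaller cylinders that cannot be separated, contradicting continuity at the limit points.\<close>

lemma disjoint_cylinder_images_separable:
  fixes f :: "(int \<Rightarrow> 'a::countable) \<Rightarrow> (int \<Rightarrow> 'b)"
  assumes cont: "cylinder_continuous f" and inj: "inj f"
    and disj: "cyl p \<alpha> \<inter> cyl q \<beta> = {}"
  shows "separable_sets (f ` cyl p \<alpha>) (f ` cyl q \<beta>)"
proof (rule ccontr)
  assume nsep: "\<not> separable_sets (f ` cyl p \<alpha>) (f ` cyl q \<beta>)"
  define bad where "bad n x \<longleftrightarrow>
      \<not> separable_sets (f ` (cyl p \<alpha> \<inter> cyl n (fst x))) (f ` (cyl q \<beta> \<inter> cyl n (snd x)))"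
    for n x
  have step: "\<exists>y. bad (Suc n) y \<and> fst y \<in> cyl n (fst x) \<and> snd y \<in> cyl n (snd x)"
    if bad: "bad n x" for n x
  proof (rule ccontr)
    assume no: "\<not> ?thesis"
    \<comment> \<open>Both cylinders split into countably many cylinders of the next level; if all
      pairs of pieces were separable, the wholes would be too.\<close>
    define D where "D \<zeta> = {c \<in> range (cyl (Suc n)). c \<subseteq> cyl n \<zeta>}" for \<zeta> :: "int \<Rightarrow> 'a"
    have ctbl: "countable (D \<zeta>)" for \<zeta>
      unfolding D_def by (intro countable_Collect countable_range_cyl)
    have cover: "cyl n \<zeta> = \<Union> (D \<zeta>)" for \<zeta>
    proof (intro equalityI subsetI)
      fix \<xi> assume "\<xi> \<in> cyl n \<zeta>"
      then have "cyl (Suc n) \<xi> \<subseteq> cyl n \<zeta>"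
        using cyl_antimono[of n "Suc n" \<xi>] cyl_eq[of \<xi> n \<zeta>] by simp
      then show "\<xi> \<in> \<Union> (D \<zeta>)"
        unfolding D_def by (intro UnionI[of "cyl (Suc n) \<xi>"]) auto
    qed (auto simp: D_def)
    have D: "\<exists>\<xi>\<in>cyl n \<zeta>. c = cyl (Suc n) \<xi>" if "c \<in> D \<zeta>" for c \<zeta>
      using that cyl_self unfolding D_def by blast
    have "separable_sets (\<Union>c\<in>D (fst x). f ` (cyl p \<alpha> \<inter> c)) (\<Union>c\<in>D (snd x). f ` (cyl q \<beta> \<inter> c))"
    proof (rule separable_sets_UN[OF ctbl ctbl])
      fix c d assume "c \<in> D (fst x)" "d \<in> D (snd x)"
      then show "separable_sets (f ` (cyl p \<alpha> \<inter> c)) (f ` (cyl q \<beta> \<inter> d))"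
        using D no unfolding bad_def by (metis fst_conv snd_conv)
    qed
    moreover have "f ` (E \<inter> cyl n \<zeta>) = (\<Union>c\<in>D \<zeta>. f ` (E \<inter> c))" for E \<zeta>
      by (subst cover) blast
    ultimately show False
      using bad unfolding bad_def by simp
  qed
  have base: "\<exists>x. bad 0 x"
    using nsep by (simp add: bad_def)
  obtain x where x: "\<And>n. bad n (x n)"
      "\<And>n. fst (x (Suc n)) \<in> cyl n (fst (x n)) \<and> snd (x (Suc n)) \<in> cyl n (snd (x n))"
    using dependent_nat_choice[where P = bad and
      Q = "\<lambda>n x y. fst y \<in> cyl n (fst x) \<and> snd y \<in> cyl n (snd x)", OF base step] by metis
  have nested: "g n \<in> cyl m (g m)" if "\<And>n. g (Suc n) \<in> cyl n (g n)" "m \<le> n"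
    for g :: "nat \<Rightarrow> int \<Rightarrow> 'a" and m n
    using that(2)
  proof (induction n rule: dec_induct)
    case (step n)
    then show ?case
      using that(1)[of n] cyl_antimono[of m n] cyl_eq by blast
  qed simp
  obtain a where a: "\<And>n. a \<in> cyl n (fst (x n))"
    by (rule cylinder_limit[of "\<lambda>n. fst (x n)"]) (use nested[of "\<lambda>n. fst (x n)"] x(2) in auto)
  obtain b where b: "\<And>n. b \<in> cyl n (snd (x n))"
    by (rule cylinder_limit[of "\<lambda>n. snd (x n)"]) (use nested[of "\<lambda>n. snd (x n)"] x(2) in auto)
  have nsep_ab: "\<not> separable_sets (f ` (cyl p \<alpha> \<inter> cyl n a)) (f ` (cyl q \<beta> \<inter> cyl n b))" for n
    using x(1)[of n] cyl_eq[OF a[of n]] cyl_eq[OF b[of n]] by (simp add: bad_def)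
  \<comment> \<open>Otherwise the level-\<open>p\<close> cylinder of \<open>a\<close> misses
    \<open>cyl p \<alpha>\<close> and the image is empty, hence trivially separable. For
    \<open>b\<close> the whole space serves as separator.\<close>
  have "a \<in> cyl p \<alpha>"
  proof (rule ccontr)
    assume "a \<notin> cyl p \<alpha>"
    then have "cyl p \<alpha> \<inter> cyl p a = {}"
      using cyl_eq by (metis Int_emptyI cyl_self)
    then show False
      using nsep_ab[of p] by (auto simp: separable_sets_def)
  qed
  moreover have "b \<in> cyl q \<beta>"
  proof (rule ccontr)
    assume "b \<notin> cyl q \<beta>"
    then have "cyl q \<beta> \<inter> cyl q b = {}"
      using cyl_eq by (metis Int_emptyI cyl_self)
    then show False
      using nsep_ab[of q] by (auto simp: separable_sets_def intro: bexI[of _ "space config_space"])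
  qed
  ultimately have "f a \<noteq> f b"
    using disj inj by (metis IntI empty_iff injD)
  \<comment> \<open>On small cylinders around \<open>a\<close> and \<open>b\<close> the images are
    constant at site \<open>i\<close> with different values, so a one-site event separates them,
    against \<open>nsep_ab\<close>.\<close>
  then obtain i where i: "f a i \<noteq> f b i"
    by auto
  obtain m where m: "\<forall>\<xi>\<in>cyl m a. f \<xi> i = f a i"
    using cylinder_continuousD[OF cont, of a i] ..
  obtain n where n: "\<forall>\<xi>\<in>cyl n b. f \<xi> i = f b i"
    using cylinder_continuousD[OF cont, of b i] ..
  define N where "N = max m n"
  have "cyl N a \<subseteq> cyl m a" "cyl N b \<subseteq> cyl n b"
    by (simp_all add: N_def cyl_antimono)
  with m n have N: "\<forall>\<xi>\<in>cyl N a. f \<xi> i = f a i" "\<forall>\<xi>\<in>cyl N b. f \<xi> i = f b i"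
    by blast+
  have "f ` cyl N b \<subseteq> {\<eta>. \<eta> i = f b i}"
    using N(2) by blast
  then have "f ` cyl N b \<inter> {\<eta>. \<eta> i = f a i} = {}"
    using i by auto
  moreover have "f ` cyl N a \<subseteq> {\<eta>. \<eta> i = f a i}"
    using N(1) by blast
  ultimately have "separable_sets (f ` (cyl p \<alpha> \<inter> cyl N a)) (f ` (cyl q \<beta> \<inter> cyl N b))"
    unfolding separable_sets_def
    by (intro bexI[of _ "{\<eta>. \<eta> i = f a i}"]) (auto simp: coordinate_in_sets)
  then show False
    using nsep_ab by blast
qed
text \<open>Each cylinder image gets a measurable envelope \<open>B c\<close> such that disjoint
  cylinders have disjoint envelopes. The range is recovered from the envelopes level by level, and
  an envelope then cuts the image of its cylinder out of the range.\<close>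

theorem Lusin_Souslin_config_space:
  fixes f :: "(int \<Rightarrow> 'a::countable) \<Rightarrow> (int \<Rightarrow> 'b::countable)"
  assumes cont: "cylinder_continuous f" and inj: "inj f" and A: "A \<in> sets config_space"
  shows "f ` A \<in> sets config_space"
proof -
  define C where "C = (\<Union>n. range (cyl n :: (int \<Rightarrow> 'a) \<Rightarrow> _))"
  have C: "countable C"
    unfolding C_def by (intro countable_UN countable_range_cyl) auto
  define separates where "separates c d B \<longleftrightarrow> B \<in> sets config_space \<and> f ` c \<subseteq> B \<and> f ` d \<inter> B = {}" for c d B
  define S where "S c d = (SOME B. separates c d B)" for c d
  have S: "separates c d (S c d)" if "c \<in> C" "d \<in> C" "c \<inter> d = {}" for c d
  proof -
    obtain m \<alpha> n \<beta> where "c = cyl m \<alpha>" "d = cyl n \<beta>"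
      using \<open>c \<in> C\<close> \<open>d \<in> C\<close> by (auto simp: C_def)
    with \<open>c \<inter> d = {}\<close> have "\<exists>B. separates c d B"
      using disjoint_cylinder_images_separable[OF cont inj, of m \<alpha> n \<beta>]
      by (auto simp: separable_sets_def separates_def)
    then show ?thesis
      unfolding S_def by (rule someI_ex)
  qed
  have S_sets: "S c d \<in> sets config_space" and S_sub: "f ` c \<subseteq> S c d" and S_disj: "f ` d \<inter> S c d = {}"
    if "c \<in> C" "d \<in> C" "c \<inter> d = {}" for c d
    using S[OF that] by (auto simp: separates_def)
  \<comment> \<open>The closure of the image of \<open>c\<close>.\<close>
  define K where "K c = {\<eta>. \<forall>N. \<exists>\<xi>\<in>c. f \<xi> \<in> cyl N \<eta>}" for c
  have K: "K c \<in> sets config_space" for c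
  proof -
    have "K c = space config_space - (\<Union>N. {\<eta>. \<forall>\<xi>\<in>c. f \<xi> \<notin> cyl N \<eta>})"
      by (auto simp: K_def)
    moreover have "{\<eta>. \<forall>\<xi>\<in>c. f \<xi> \<notin> cyl N \<eta>} \<in> sets config_space" for N
    proof (rule open_in_sets)
      fix \<eta> assume "\<eta> \<in> {\<eta>. \<forall>\<xi>\<in>c. f \<xi> \<notin> cyl N \<eta>}"
      then have "cyl N \<eta> \<subseteq> {\<eta>. \<forall>\<xi>\<in>c. f \<xi> \<notin> cyl N \<eta>}"
        using cyl_eq by blast
      then show "\<exists>n. cyl n \<eta> \<subseteq> {\<eta>. \<forall>\<xi>\<in>c. f \<xi> \<notin> cyl N \<eta>}" ..
    qed
    ultimately show ?thesis
      by auto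
  qed
  \<comment> \<open>\<open>S c d\<close> and \<open>S d c\<close> are chosen independently; points
    of \<open>B c\<close> must lie in the first and outside the second, so that \<open>S c d\<close>
    contains \<open>B c\<close> and misses \<open>B d\<close>.\<close>
  define B where "B c = K c \<inter> (space config_space -
      (\<Union>d\<in>{d \<in> C. c \<inter> d = {}}. S d c \<union> (space config_space - S c d)))" for c
  have B: "B c \<in> sets config_space" if "c \<in> C" for c
  proof -
    have "(\<Union>d\<in>{d \<in> C. c \<inter> d = {}}. S d c \<union> (space config_space - S c d)) \<in> sets config_space"
      by (rule sets.countable_UN') (use C S_sets that in \<open>auto simp: Int_commute simp del: space_config_space\<close>)
    then show ?thesis
      unfolding B_def by (intro sets.Int K sets.Diff sets.top)
  qed
  have f_B: "f ` c \<subseteq> B c" if "c \<in> C" for c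
  proof
    fix \<eta> assume \<eta>: "\<eta> \<in> f ` c"
    have "\<eta> \<in> K c"
      unfolding K_def using \<eta> cyl_self by blast
    moreover have "\<eta> \<in> S c d \<and> \<eta> \<notin> S d c" if d: "d \<in> C" "c \<inter> d = {}" for d
    proof -
      have "d \<inter> c = {}"
        using d by blast
      then show ?thesis
        using \<eta> S_sub[OF \<open>c \<in> C\<close> d] S_disj[OF d(1) \<open>c \<in> C\<close>] by blast
    qed
    ultimately show "\<eta> \<in> B c"
      by (auto simp: B_def)
  qed
  have f_in_B: "f \<zeta> \<in> B (cyl n \<zeta>)" for n \<zeta>
  proof -
    have "cyl n \<zeta> \<in> C"
      by (auto simp: C_def)
    from f_B[OF this] show ?thesis
      using cyl_self by blast
  qed
  have B_disj: "B c \<inter> B d = {}" if "c \<in> C" "d \<in> C" "c \<inter> d = {}" for c d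
  proof -
    have "d \<inter> c = {}"
      using that by blast
    then have "B c \<subseteq> S c d" "B d \<inter> S c d = {}"
      using that by (auto simp: B_def)
    then show ?thesis
      by blast
  qed
  \<comment> \<open>A point of the right-hand side selects a cylinder on each level. Their envelopes
    share the point, so the cylinders meet pairwise, are nested and shrink to some \<open>x\<close>.
    The closures \<open>K\<close> supply points of these cylinders with images close to
    \<open>\<eta>\<close>, and continuity at \<open>x\<close> gives
    \<open>f x = \<eta>\<close>.\<close>
  have range_f: "range f = (\<Inter>n. \<Union>c\<in>range (cyl n). B c)"
  proof (intro equalityI subsetI)
    fix \<eta> assume "\<eta> \<in> range f"
    then obtain \<zeta> where "\<eta> = f \<zeta>" by auto
    moreover have "f \<zeta> \<in> B (cyl n \<zeta>)" for n
      by (rule f_in_B)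
    ultimately show "\<eta> \<in> (\<Inter>n. \<Union>c\<in>range (cyl n). B c)"
      by auto
  next
    fix \<eta> assume "\<eta> \<in> (\<Inter>n. \<Union>c\<in>range (cyl n). B c)"
    then have "\<forall>n. \<exists>\<zeta>. \<eta> \<in> B (cyl n \<zeta>)"
      by auto
    then obtain a where a: "\<And>n. \<eta> \<in> B (cyl n (a n))"
      by metis
    obtain x where x: "\<And>n. x \<in> cyl n (a n)"
    proof (rule cylinder_limit[of a])
      fix m n :: nat assume "m \<le> n"
      have "cyl m (a m) \<inter> cyl n (a n) \<noteq> {}"
        using B_disj[of "cyl m (a m)" "cyl n (a n)"] a[of m] a[of n] by (auto simp: C_def)
      then obtain \<xi> where "\<xi> \<in> cyl m (a m)" "\<xi> \<in> cyl n (a n)"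
        by auto
      then show "a n \<in> cyl m (a m)"
        using cyl_antimono[OF \<open>m \<le> n\<close>] cyl_eq cyl_self by blast
    qed blast
    have "f x i = \<eta> i" for i
    proof -
      obtain n where n: "\<forall>\<xi>\<in>cyl n x. f \<xi> i = f x i"
        using cylinder_continuousD[OF cont, of x i] ..
      have "\<eta> \<in> K (cyl n (a n))"
        using a[of n] by (simp add: B_def)
      then obtain \<xi> where \<xi>: "\<xi> \<in> cyl n (a n)" "f \<xi> \<in> cyl (nat \<bar>i\<bar> + 1) \<eta>"
        unfolding K_def by blast
      then have "f \<xi> i = \<eta> i"
        by (simp add: cyl_def)
      moreover have "\<xi> \<in> cyl n x"
        using \<xi>(1) cyl_eq[OF x[of n]] by simp
      ultimately show ?thesis
        using n by metis
    qed
    then show "\<eta> \<in> range f"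
      by (metis ext rangeI)
  qed
  have range_sets: "range f \<in> sets config_space"
    unfolding range_f
    by (intro sets.countable_INT'' sets.countable_UN' countable_range_cyl) (use B in \<open>auto simp: C_def\<close>)
  have cyl_sets: "f ` c \<in> sets config_space" if c: "c \<in> C" for c
  proof -
    have "f ` c = range f \<inter> B c"
    proof (intro equalityI subsetI)
      fix \<eta> assume \<eta>: "\<eta> \<in> range f \<inter> B c"
      then obtain \<zeta> where \<zeta>: "\<eta> = f \<zeta>" by auto
      obtain n \<alpha> where n: "c = cyl n \<alpha>"
        using c by (auto simp: C_def)
      have "f \<zeta> \<in> B (cyl n \<zeta>)"
        by (rule f_in_B)
      \<comment> \<open>Since \<open>cyl n \<zeta>\<close> has the same level as \<open>c\<close>,
        meeting \<open>c\<close> means being equal to it.\<close>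
      then have "cyl n \<zeta> \<inter> c \<noteq> {}"
        using B_disj[of "cyl n \<zeta>" c] c \<eta> \<zeta> by (auto simp: C_def)
      then have "cyl n \<zeta> = c"
        using cyl_eq n by blast
      then show "\<eta> \<in> f ` c"
        using \<zeta> cyl_self by blast
    qed (use f_B[OF c] in auto)
    then show ?thesis
      using range_sets B[OF c] by simp
  qed
  have coord: "f ` {\<zeta>. \<zeta> i = a} \<in> sets config_space" for i a
  proof -
    let ?D = "{c \<in> C. c \<subseteq> {\<zeta>. \<zeta> i = a}}"
    have "\<zeta> \<in> \<Union> ?D" if "\<zeta> i = a" for \<zeta>
    proof (rule UnionI)
      have "cyl (nat \<bar>i\<bar> + 1) \<zeta> \<subseteq> {\<zeta>. \<zeta> i = a}"
        using that by (auto simp: cyl_def)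
      then show "cyl (nat \<bar>i\<bar> + 1) \<zeta> \<in> ?D"
        unfolding C_def by blast
    qed simp
    then have "{\<zeta>. \<zeta> i = a} = \<Union> ?D"
      by auto
    then have "f ` {\<zeta>. \<zeta> i = a} = (\<Union>c\<in>?D. f ` c)"
      by blast
    also have "\<dots> \<in> sets config_space"
      by (intro sets.countable_UN' countable_Collect C) (use cyl_sets in auto)
    finally show ?thesis .
  qed
  \<comment> \<open>Good-sets argument: by injectivity the image of a complement is the complement
    of the image within the measurable range.\<close>
  define \<Sigma> where "\<Sigma> = {A. f ` A \<in> sets config_space}"
  have "sigma_algebra UNIV \<Sigma>"
    unfolding sigma_algebra_iff2
  proof (intro conjI ballI allI impI)
    fix A assume "A \<in> \<Sigma>"
    then show "UNIV - A \<in> \<Sigma>"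
      using range_sets by (simp add: \<Sigma>_def image_set_diff[OF inj])
  next
    fix A :: "nat \<Rightarrow> _" assume "range A \<subseteq> \<Sigma>"
    then show "(\<Union>i. A i) \<in> \<Sigma>"
      unfolding \<Sigma>_def by (auto simp: image_UN)
  qed (auto simp: \<Sigma>_def)
  then interpret sigma_algebra UNIV \<Sigma> .
  \<comment> \<open>Measurability of the identity says that every measurable set belongs to
    \<open>\<Sigma>\<close>, and it need only be checked on one-site events.\<close>
  have "(\<lambda>\<zeta>. \<zeta>) \<in> measurable (measure_of UNIV \<Sigma> (\<lambda>_. 0)) config_space"
    by (rule measurable_config_spaceI) (use coord in \<open>simp add: \<Sigma>_def\<close>)
  from measurable_sets[OF this A] have "A \<in> \<Sigma>"
    by (simp add: sigma_sets_eq)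
  then show ?thesis
    by (simp add: \<Sigma>_def)
qed

section \<open>The substitution map\<close>

lemma inj_translate: "inj (translate n)"
proof
  fix \<eta> \<xi> :: "int \<Rightarrow> 'a" assume "translate n \<eta> = translate n \<xi>"
  then have "translate (- n + n) \<eta> = translate (- n + n) \<xi>"
    by (simp only: translate_add o_apply)
  then show "\<eta> = \<xi>"
    by (simp add: translate_0)
qed

lemma translate_translate: "translate m (translate n \<eta>) = translate (m + n) \<eta>"
  by (simp add: translate_add)

lemma translate_image: "translate n ` A = translate (- n) -` A"
proof (intro equalityI subsetI)
  fix \<eta> assume "\<eta> \<in> translate (- n) -` A"
  then have "translate n (translate (- n) \<eta>) \<in> translate n ` A"
    by blast
  then show "\<eta> \<in> translate n ` A"
    by (simp add: translate_translate translate_0)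
qed (auto simp: translate_translate translate_0)

lemma translate_measurable [measurable]:
  "(translate n :: (int \<Rightarrow> 'a::countable) \<Rightarrow> _) \<in> measurable config_space config_space"
  by (rule measurable_config_spaceI) (simp add: translate_def coordinate_in_sets)

lemma translate_vimage_sets:
  fixes A :: "(int \<Rightarrow> 'a::countable) set"
  shows "A \<in> sets config_space \<Longrightarrow> translate n -` A \<in> sets config_space"
  using measurable_sets[OF translate_measurable[of n], of A] by simp

text \<open>Block \<open>n\<close> of the shifted configuration is block \<open>n + m\<close> of the
  original; the correction makes block \<open>m + 1\<close>, now the first one, begin at site
  1.\<close>

lemma block_start_translate:
  "block_start w (translate (- m) \<zeta>) n = block_start w \<zeta> (n + m) - block_start w \<zeta> (m + 1) + 1"
proof (induction n rule: int_induct[where k = 1])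
  case base
  show ?case by (simp add: add.commute)
next
  case (step1 n)
  then show ?case
    using block_start_Suc[of w "translate (- m) \<zeta>" n] block_start_Suc[of w \<zeta> "n + m"]
    by (simp add: translate_def algebra_simps)
next
  case (step2 n)
  then show ?case
    using block_start_Suc[of w "translate (- m) \<zeta>" "n - 1"] block_start_Suc[of w \<zeta> "n - 1 + m"]
    by (simp add: translate_def algebra_simps)
qed

text \<open>Skipping \<open>m\<close> letters skips their words in the concatenation, so the image
  moves by their total length, counted with sign for negative \<open>m\<close>.\<close>

lemma subst_map_translate:
  assumes "\<And>s. w s \<noteq> []"
  shows "subst_map w (translate (- m) \<zeta>) = translate (1 - block_start w \<zeta> (m + 1)) (subst_map w \<zeta>)"
proof
  fix i
  obtain n j where n: "j < length (w (translate (- m) \<zeta> n))" "i = block_start w (translate (- m) \<zeta>) n + int j"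
    using block_exists[of w "translate (- m) \<zeta>" i] assms by blast
  have "subst_map w (translate (- m) \<zeta>) i = w (\<zeta> (n + m)) ! j"
    unfolding n(2) by (subst subst_map_block) (use n in \<open>auto simp: translate_def\<close>)
  also have "\<dots> = subst_map w \<zeta> (block_start w \<zeta> (n + m) + int j)"
    by (rule subst_map_block[symmetric]) (use n in \<open>auto simp: translate_def\<close>)
  also have "\<dots> = translate (1 - block_start w \<zeta> (m + 1)) (subst_map w \<zeta>) i"
    unfolding n(2) block_start_translate by (simp add: translate_def algebra_simps)
  finally show "subst_map w (translate (- m) \<zeta>) i = translate (1 - block_start w \<zeta> (m + 1)) (subst_map w \<zeta>) i" .
qed

section \<open>Injectivity from disjointness\<close>

locale substitution =
  fixes w :: "'s::countable \<Rightarrow> 't::countable list"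
  assumes word_nonempty: "\<And>s. w s \<noteq> []"
    and Y_shift_disjoint: "disjoint_family_on (\<lambda>(s, j). Y_shift w s j) (SIGMA s:UNIV. {..<length (w s)})"
begin

abbreviation \<phi> :: "(int \<Rightarrow> 's) \<Rightarrow> (int \<Rightarrow> 't)" where
  "\<phi> \<equiv> subst_map w"

abbreviation len :: "(int \<Rightarrow> 's) \<Rightarrow> nat" where
  "len \<zeta> \<equiv> length (w (\<zeta> 1))"

lemma len_pos: "0 < len \<zeta>"
  using word_nonempty by simp

lemma subst_map_translate_left: "\<phi> (translate (- 1) \<zeta>) = translate (- int (len \<zeta>)) (\<phi> \<zeta>)"
  using subst_map_translate[of w 1 \<zeta>] word_nonempty block_start_Suc[of w \<zeta> 1] by simp

lemma subst_map_translate_right: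
  "\<phi> (translate 1 \<zeta>) = translate (int (len (translate 1 \<zeta>))) (\<phi> \<zeta>)"
proof -
  have "\<phi> \<zeta> = translate (- int (len (translate 1 \<zeta>))) (\<phi> (translate 1 \<zeta>))"
    using subst_map_translate_left[of "translate 1 \<zeta>"] by (simp add: translate_translate translate_0)
  then show ?thesis
    by (metis add.right_inverse id_apply translate_0 translate_translate)
qed

lemma translate_subst_map:
  obtains m j where "j < len (translate (- m) \<zeta>)"
    "translate (- n) (\<phi> \<zeta>) = translate (- int j) (\<phi> (translate (- m) \<zeta>))"
proof -
  \<comment> \<open>Translation by \<open>- n\<close> brings site \<open>n + 1\<close> to site 1, so
    the block of that site must become block 1, and the offset in it is the level
    \<open>j\<close>.\<close>
  obtain m j where m: "j < length (w (\<zeta> m))" "n + 1 = block_start w \<zeta> m + int j"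
    using block_exists[of w \<zeta> "n + 1"] word_nonempty by blast
  have "translate (- int j) (\<phi> (translate (- (m - 1)) \<zeta>)) = translate (- int j + (1 - block_start w \<zeta> m)) (\<phi> \<zeta>)"
    using subst_map_translate[of w "m - 1" \<zeta>] word_nonempty by (simp add: translate_translate)
  also have "- int j + (1 - block_start w \<zeta> m) = - n"
    using m(2) by simp
  finally show ?thesis
    using m(1) by (intro that[of j "m - 1"]) (simp_all add: translate_def)
qed

lemma Y_shift_eq: "Y_shift w s j = translate (- int j) ` \<phi> ` Yhat_sub s"
  by (simp add: Y_shift_def Y_sub_def)

lemma letter_determined:
  assumes "j < len \<zeta>" "k < len \<xi>" and eq: "translate (- int j) (\<phi> \<zeta>) = translate (- int k) (\<phi> \<xi>)"
  shows "\<zeta> 1 = \<xi> 1 \<and> j = k"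
proof (rule ccontr)
  assume "\<not> ?thesis"
  then have "Y_shift w (\<zeta> 1) j \<inter> Y_shift w (\<xi> 1) k = {}"
    using disjoint_family_onD[OF Y_shift_disjoint, of "(\<zeta> 1, j)" "(\<xi> 1, k)"] assms(1,2) by auto
  moreover have "translate (- int j) (\<phi> \<zeta>) \<in> Y_shift w (\<zeta> 1) j"
    unfolding Y_shift_eq by (intro imageI) (simp add: Yhat_sub_def)
  moreover have "translate (- int k) (\<phi> \<xi>) \<in> Y_shift w (\<xi> 1) k"
    unfolding Y_shift_eq by (intro imageI) (simp add: Yhat_sub_def)
  ultimately show False
    using eq by (metis disjoint_iff)
qed

lemma inj_subst_map: "inj \<phi>"
proof
  fix \<zeta> \<xi> :: "int \<Rightarrow> 's"
  assume eq: "\<phi> \<zeta> = \<phi> \<xi>"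
  have left: "\<alpha> 1 = \<beta> 1" if "\<phi> \<alpha> = \<phi> \<beta>" for \<alpha> \<beta>
    using letter_determined[of 0 \<alpha> 0 \<beta>] that len_pos by simp
  have right: "\<alpha> 0 = \<beta> 0" if "\<phi> \<alpha> = \<phi> \<beta>" for \<alpha> \<beta>
  proof -
    \<comment> \<open>Site 0 carries the last letter of the word of \<open>\<gamma> 0\<close>.
      Translation by 1 brings it to site 1, which is the top level \<open>len - 1\<close> over
      \<open>translate 1 \<gamma>\<close>.\<close>
    have last_letter: "translate (- int (len (translate 1 \<gamma>) - 1)) (\<phi> (translate 1 \<gamma>)) = translate 1 (\<phi> \<gamma>)" for \<gamma>
    proof -
      have "- int (len (translate 1 \<gamma>) - 1) + int (len (translate 1 \<gamma>)) = 1"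
        using len_pos[of "translate 1 \<gamma>"] by linarith
      then show ?thesis
        by (simp only: subst_map_translate_right translate_translate)
    qed
    have "translate 1 \<alpha> 1 = translate 1 \<beta> 1 \<and> len (translate 1 \<alpha>) - 1 = len (translate 1 \<beta>) - 1"
      by (rule letter_determined) (simp_all only: last_letter that diff_less len_pos zero_less_one)
    then show ?thesis
      by (simp add: translate_def)
  qed
  \<comment> \<open>Equality of images spreads along both orbits: a common letter means a common
    word length, so one more block can be passed on either side.\<close>
  have "\<phi> (translate (- m) \<zeta>) = \<phi> (translate (- m) \<xi>)" for m
  proof (induction m rule: int_induct[where k = 0])
    case base
    show ?case by (simp add: eq translate_0)
  next
    case (step1 m)
    then show ?case
      using subst_map_translate_left[of "translate (- m) \<zeta>"] subst_map_translate_left[of "translate (- m) \<xi>"]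
        left[of "translate (- m) \<zeta>" "translate (- m) \<xi>"]
      by (simp add: translate_translate minus_diff_commute)
  next
    case (step2 m)
    have "translate 1 (translate (- m) \<zeta>) 1 = translate 1 (translate (- m) \<xi>) 1"
      using right[OF step2(2)] by (simp add: translate_def)
    then have "\<phi> (translate 1 (translate (- m) \<zeta>)) = \<phi> (translate 1 (translate (- m) \<xi>))"
      using step2(2) unfolding subst_map_translate_right by simp
    then show ?case
      by (simp add: translate_translate)
  qed
  from left[OF this] have "\<zeta> (1 + m) = \<xi> (1 + m)" for m
    by (simp add: translate_def)
  from this[of "i - 1" for i] show "\<zeta> = \<xi>"
    by auto
qed

lemma position_determined:
  assumes "j < len \<zeta>" "k < len \<xi>" "translate (- int j) (\<phi> \<zeta>) = translate (- int k) (\<phi> \<xi>)"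
  shows "\<zeta> = \<xi>" "j = k"
proof -
  show "j = k"
    using letter_determined[OF assms] by simp
  then show "\<zeta> = \<xi>"
    using assms(3) inj_translate inj_subst_map by (metis injD)
qed

section \<open>Continuity and measurability of the substitution\<close>

lemma cylinder_continuous_subst_map: "cylinder_continuous \<phi>"
  unfolding cylinder_continuous_def
proof (intro allI)
  fix \<zeta> i
  obtain n j where n: "j < length (w (\<zeta> n))" "i = block_start w \<zeta> n + int j"
    using block_exists[of w \<zeta> i] word_nonempty by blast
  \<comment> \<open>The window contains every site between 1 and \<open>n\<close>, so
    \<open>\<xi>\<close> has the same start of block \<open>n\<close> and the same word in it as
    \<open>\<zeta>\<close>.\<close>
  have "\<phi> \<xi> i = \<phi> \<zeta> i" if "\<xi> \<in> cyl (nat (\<bar>n\<bar> + 2)) \<zeta>" for \<xi>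
  proof -
    have eq: "\<xi> m = \<zeta> m" if "\<bar>m\<bar> < \<bar>n\<bar> + 2" for m
      using \<open>\<xi> \<in> _\<close> that by (simp add: cyl_def)
    have "(\<Sum>m\<in>{1..<n}. int (length (w (\<xi> m)))) = (\<Sum>m\<in>{1..<n}. int (length (w (\<zeta> m))))"
      by (rule sum.cong) (auto simp: eq)
    moreover have "(\<Sum>m\<in>{n..<1}. int (length (w (\<xi> m)))) = (\<Sum>m\<in>{n..<1}. int (length (w (\<zeta> m))))"
      by (rule sum.cong) (auto simp: eq)
    ultimately have "block_start w \<xi> n = block_start w \<zeta> n"
      by (simp add: block_start_def)
    then show ?thesis
      using subst_map_block[of j w \<xi> n] subst_map_block[of j w \<zeta> n] n eq[of n] by simp
  qed
  then show "\<exists>n. \<forall>\<xi>\<in>cyl n \<zeta>. \<phi> \<xi> i = \<phi> \<zeta> i"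
    by blast
qed

lemma subst_map_measurable [measurable]: "\<phi> \<in> measurable config_space config_space"
  by (rule cylinder_continuous_measurable[OF cylinder_continuous_subst_map])

lemma subst_map_image_sets: "A \<in> sets config_space \<Longrightarrow> \<phi> ` A \<in> sets config_space"
  by (rule Lusin_Souslin_config_space[OF cylinder_continuous_subst_map inj_subst_map])

lemma subst_map_vimage_sets: "A \<in> sets config_space \<Longrightarrow> \<phi> -` A \<in> sets config_space"
  using measurable_sets[OF subst_map_measurable, of A] by simp

lemma Yhat_sub_sets [measurable]: "Yhat_sub s \<in> sets config_space"
  by (simp add: Yhat_sub_def coordinate_in_sets)

lemma Y_shift_sets: "Y_shift w s j \<in> sets config_space"
  unfolding Y_shift_eq translate_image by (intro translate_vimage_sets subst_map_image_sets Yhat_sub_sets)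

end

section \<open>The induced maps of measures\<close>

lemma TI_prob_emeasure_vimage:
  fixes \<nu> :: "(int \<Rightarrow> 'a::countable) measure"
  assumes "TI_prob \<nu>" "A \<in> sets config_space"
  shows "emeasure \<nu> (translate n -` A) = emeasure \<nu> A"
proof -
  have sets: "sets \<nu> = sets config_space" and inv: "distr \<nu> config_space (translate 1) = \<nu>"
    using assms(1) by (auto simp: TI_prob_def)
  have space: "space \<nu> = UNIV"
    using sets_eq_imp_space_eq[OF sets] by simp
  have tr: "translate 1 \<in> measurable \<nu> config_space"
    using measurable_cong_sets[OF sets refl] translate_measurable by blast
  have one: "emeasure \<nu> (translate 1 -` B) = emeasure \<nu> B" if "B \<in> sets config_space" for B
    using emeasure_distr[OF tr that] inv space by simp
  have vimage_vimage: "translate m -` translate k -` B = translate (k + m) -` B" for m k and B :: "(int \<Rightarrow> 'a) set"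
    by (auto simp: translate_translate)
  show ?thesis
  proof (induction n rule: int_induct[where k = 0])
    case base
    show ?case by (simp add: translate_0)
  next
    case (step1 n)
    then show ?case
      using one[OF translate_vimage_sets[OF assms(2), of n]] by (simp add: vimage_vimage)
  next
    case (step2 n)
    then show ?case
      using one[OF translate_vimage_sets[OF assms(2), of "n - 1"]] by (simp add: vimage_vimage)
  qed
qed

lemma TI_prob_emeasure_image:
  fixes \<nu> :: "(int \<Rightarrow> 'a::countable) measure"
  shows "TI_prob \<nu> \<Longrightarrow> A \<in> sets config_space \<Longrightarrow> emeasure \<nu> (translate n ` A) = emeasure \<nu> A"
  unfolding translate_image by (rule TI_prob_emeasure_vimage)

lemma TI_probI:
  fixes \<nu> :: "(int \<Rightarrow> 'a::countable) measure"
  assumes sets: "sets \<nu> = sets config_space" and "emeasure \<nu> UNIV = 1"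
    and inv: "\<And>A. A \<in> sets config_space \<Longrightarrow> emeasure \<nu> (translate 1 -` A) = emeasure \<nu> A"
  shows "TI_prob \<nu>"
  unfolding TI_prob_def
proof (intro conjI sets)
  have space: "space \<nu> = UNIV"
    using sets_eq_imp_space_eq[OF sets] by simp
  then show "prob_space \<nu>"
    using assms(2) by (intro prob_spaceI) simp
  have tr: "translate 1 \<in> measurable \<nu> config_space"
    using measurable_cong_sets[OF sets refl] translate_measurable by blast
  show "distr \<nu> config_space (translate 1) = \<nu>"
    by (rule measure_eqI) (simp_all add: sets emeasure_distr[OF tr] space inv)
qed

lemma TI_prob_sets: "TI_prob \<nu> \<Longrightarrow> sets \<nu> = sets config_space"
  by (simp add: TI_prob_def)

lemma TI_prob_space: "TI_prob \<nu> \<Longrightarrow> space \<nu> = UNIV"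
  using sets_eq_imp_space_eq[OF TI_prob_sets] by fastforce

lemma TI_prob_UNIV: "TI_prob \<nu> \<Longrightarrow> emeasure \<nu> UNIV = 1"
  using prob_space.emeasure_space_1[of \<nu>] by (simp add: TI_prob_space) (simp add: TI_prob_def)

lemma TI_prob_finite: "TI_prob \<nu> \<Longrightarrow> emeasure \<nu> A \<noteq> \<infinity>"
  using finite_measure.emeasure_finite[of \<nu> A] by (simp add: TI_prob_def prob_space_def)

lemma ennreal_inverse_mult_self: "x \<noteq> 0 \<Longrightarrow> x \<noteq> \<top> \<Longrightarrow> inverse x * x = (1 :: ennreal)"
  using ennreal_divide_self[of x] by (simp add: divide_ennreal_def mult.commute less_top)

text \<open>Null sets, unlike the value 1, can be compared across \<open>Phi\<close> without regard
  to weights and normalization.\<close>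

lemma ergodic_iff_null:
  assumes "TI_prob \<nu>"
  shows "ergodic \<nu> \<longleftrightarrow> (\<forall>A\<in>sets config_space. translate 1 -` A = A \<longrightarrow> emeasure \<nu> A = 0 \<or> emeasure \<nu> (- A) = 0)"
proof -
  interpret prob_space \<nu>
    using assms by (simp add: TI_prob_def)
  have "emeasure \<nu> A = 1 \<longleftrightarrow> emeasure \<nu> (- A) = 0" if "A \<in> sets config_space" for A
  proof -
    have A: "A \<in> events"
      using that assms by (simp add: TI_prob_sets)
    then have "prob (- A) = 1 - prob A"
      using prob_compl[OF A] TI_prob_space[OF assms] by (simp add: Compl_eq_Diff_UNIV)
    then show ?thesis
      by (simp add: emeasure_eq_measure)
  qed
  then show ?thesis
    using assms by (auto simp: ergodic_def TI_prob_sets)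
qed

context substitution
begin

section \<open>\<open>Phi\<close> as an integral of visit counts\<close>

lemma Yhat_sub_disjoint: "disjoint_family_on (\<lambda>s. A \<inter> Yhat_sub s) S"
  by (auto simp: disjoint_family_on_def Yhat_sub_def)

text \<open>By Tonelli, and because only \<open>s = \<zeta> 1\<close> contributes to the inner sum.
  This collapses the letterwise sums in \<open>Phi\<close> and \<open>Z_hat\<close> into single
  integrals.\<close>

lemma integral_first_letter:
  fixes f :: "'s \<Rightarrow> (int \<Rightarrow> 's) \<Rightarrow> ennreal"
  assumes sets: "sets \<mu> = sets config_space"
    and f: "\<And>s. f s \<in> borel_measurable config_space"
  shows "(\<integral>\<^sup>+s. (\<integral>\<^sup>+\<zeta>. indicator (Yhat_sub s) \<zeta> * f s \<zeta> \<partial>\<mu>) \<partial>count_space UNIV) = (\<integral>\<^sup>+\<zeta>. f (\<zeta> 1) \<zeta> \<partial>\<mu>)"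
proof -
  have meas: "(\<lambda>\<zeta>. indicator (Yhat_sub s) \<zeta> * f s \<zeta>) \<in> borel_measurable \<mu>" for s
  proof -
    have "(\<lambda>\<zeta>. indicator (Yhat_sub s) \<zeta> * f s \<zeta>) \<in> borel_measurable config_space"
      using f by measurable
    then show ?thesis
      using measurable_cong_sets[OF sets refl] by blast
  qed
  have "(\<integral>\<^sup>+s. (\<integral>\<^sup>+\<zeta>. indicator (Yhat_sub s) \<zeta> * f s \<zeta> \<partial>\<mu>) \<partial>count_space UNIV) =
      (\<integral>\<^sup>+\<zeta>. (\<integral>\<^sup>+s. indicator (Yhat_sub s) \<zeta> * f s \<zeta> \<partial>count_space UNIV) \<partial>\<mu>)"
    by (rule nn_integral_count_space_nn_integral[symmetric]) (use meas in auto)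
  also have "\<dots> = (\<integral>\<^sup>+\<zeta>. f (\<zeta> 1) \<zeta> \<partial>\<mu>)"
  proof (rule nn_integral_cong)
    fix \<zeta> :: "int \<Rightarrow> 's"
    show "(\<integral>\<^sup>+s. indicator (Yhat_sub s) \<zeta> * f s \<zeta> \<partial>count_space UNIV) = f (\<zeta> 1) \<zeta>"
      by (subst nn_integral_count_space'[of "{\<zeta> 1}"]) (auto simp: Yhat_sub_def indicator_def)
  qed
  finally show ?thesis .
qed

text \<open>An occupation count: how many sites of block 1, when moved to site 1, show a
  configuration in \<open>A\<close>.\<close>

definition visits :: "(int \<Rightarrow> 't) set \<Rightarrow> (int \<Rightarrow> 's) \<Rightarrow> ennreal" where
  "visits A \<zeta> = (\<Sum>j<len \<zeta>. indicator A (translate (- int j) (\<phi> \<zeta>)))"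

lemma visit_measurable:
  assumes A: "A \<in> sets config_space"
  shows "(\<lambda>\<zeta>. indicator A (translate (- int j) (\<phi> \<zeta>)) :: ennreal) \<in> borel_measurable config_space"
proof -
  have "(\<lambda>\<zeta>. translate (- int j) (\<phi> \<zeta>)) \<in> measurable config_space config_space"
    by (rule measurable_compose[OF subst_map_measurable translate_measurable])
  from measurable_compose[OF this borel_measurable_indicator[OF A]] show ?thesis .
qed

lemma coordinate_measurable [measurable]: "(\<lambda>\<zeta>. \<zeta> i) \<in> measurable config_space (count_space UNIV)"
  unfolding config_space_def by measurable

lemma visits_measurable:
  assumes A: "A \<in> sets config_space"
  shows "visits A \<in> borel_measurable config_space"
proof -
  \<comment> \<open>The number of summands varies with \<open>\<zeta>\<close>, but only through the
    countably valued \<open>\<zeta> 1\<close>, so it may be held fixed.\<close>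
  have "(\<lambda>\<zeta>. (\<lambda>s \<zeta>. \<Sum>j<length (w s). indicator A (translate (- int j) (\<phi> \<zeta>)) :: ennreal) (\<zeta> 1) \<zeta>)
      \<in> borel_measurable config_space"
    by (rule measurable_compose_countable[OF _ coordinate_measurable])
       (intro borel_measurable_sum visit_measurable A)
  then show ?thesis
    by (simp add: visits_def[abs_def])
qed

lemma sets_Phi [simp]: "sets (Phi w \<mu>) = sets config_space"
  by (simp add: Phi_def)

lemma emeasure_Phi_sum:
  assumes sets: "sets \<mu> = sets config_space" and A: "A \<in> sets config_space"
  shows "emeasure (Phi w \<mu>) A = inverse (Z_hat w \<mu>) *
    (\<integral>\<^sup>+s. (\<Sum>j<length (w s). emeasure \<mu> (phi_shift w j -` A \<inter> Yhat_sub s)) \<partial>count_space UNIV)"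
proof -
  have space: "space \<mu> = UNIV"
    using sets_eq_imp_space_eq[OF sets] by simp
  have "emeasure (distr (restrict_space \<mu> (Yhat_sub s)) config_space (phi_shift w j)) A =
      emeasure \<mu> (phi_shift w j -` A \<inter> Yhat_sub s)" for s j
  proof -
    have "phi_shift w j \<in> measurable config_space config_space"
      unfolding phi_shift_def by (rule measurable_comp[OF subst_map_measurable translate_measurable])
    then have "phi_shift w j \<in> measurable \<mu> config_space"
      using measurable_cong_sets[OF sets refl] by blast
    then have "phi_shift w j \<in> measurable (restrict_space \<mu> (Yhat_sub s)) config_space"
      by (rule measurable_restrict_space1)
    from emeasure_distr[OF this A] show ?thesis
      by (simp add: emeasure_restrict_space space_restrict_space space sets)
  qed
  then show ?thesis
    by (simp add: Phi_def emeasure_scale_measure emeasure_sum_measure A nn_integral_count_space_finite)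
qed

lemma emeasure_Phi:
  assumes sets: "sets \<mu> = sets config_space" and A: "A \<in> sets config_space"
  shows "emeasure (Phi w \<mu>) A = inverse (Z_hat w \<mu>) * (\<integral>\<^sup>+\<zeta>. visits A \<zeta> \<partial>\<mu>)"
proof -
  have "(\<Sum>j<length (w s). emeasure \<mu> (phi_shift w j -` A \<inter> Yhat_sub s)) =
      (\<integral>\<^sup>+\<zeta>. indicator (Yhat_sub s) \<zeta> * (\<Sum>j<length (w s). indicator A (translate (- int j) (\<phi> \<zeta>))) \<partial>\<mu>)" for s
  proof -
    have phi_sets: "phi_shift w j -` A \<inter> Yhat_sub s \<in> sets \<mu>" for j
      unfolding phi_shift_def vimage_comp[symmetric] sets
      by (intro sets.Int Yhat_sub_sets subst_map_vimage_sets translate_vimage_sets A)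
    have "(\<integral>\<^sup>+\<zeta>. indicator (Yhat_sub s) \<zeta> * (\<Sum>j<length (w s). indicator A (translate (- int j) (\<phi> \<zeta>))) \<partial>\<mu>) =
       (\<integral>\<^sup>+\<zeta>. (\<Sum>j<length (w s). indicator (phi_shift w j -` A \<inter> Yhat_sub s) \<zeta>) \<partial>\<mu>)"
      by (intro nn_integral_cong) (auto simp: phi_shift_def indicator_def sum_distrib_left intro!: sum.cong)
    also have "\<dots> = (\<Sum>j<length (w s). emeasure \<mu> (phi_shift w j -` A \<inter> Yhat_sub s))"
      by (subst nn_integral_sum) (use phi_sets in auto)
    finally show ?thesis ..
  qed
  then have "emeasure (Phi w \<mu>) A = inverse (Z_hat w \<mu>) * (\<integral>\<^sup>+s. (\<integral>\<^sup>+\<zeta>. indicator (Yhat_sub s) \<zeta> *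
      (\<Sum>j<length (w s). indicator A (translate (- int j) (\<phi> \<zeta>))) \<partial>\<mu>) \<partial>count_space UNIV)"
    by (simp add: emeasure_Phi_sum[OF assms])
  then show ?thesis
    by (subst (asm) integral_first_letter[OF sets])
       (auto simp: visits_def intro!: borel_measurable_sum visit_measurable A)
qed

text \<open>The normalization is the mean length of block 1, that is, the integral of
  \<open>visits UNIV\<close>.\<close>

lemma Z_hat_eq:
  assumes sets: "sets \<mu> = sets config_space"
  shows "Z_hat w \<mu> = (\<integral>\<^sup>+\<zeta>. of_nat (len \<zeta>) \<partial>\<mu>)"
proof -
  have "of_nat (length (w s)) * emeasure \<mu> (Yhat_sub s) =
      (\<integral>\<^sup>+\<zeta>. indicator (Yhat_sub s) \<zeta> * of_nat (length (w s)) \<partial>\<mu>)" for s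
    by (subst nn_integral_multc) (use sets in \<open>auto simp: mult.commute\<close>)
  then show ?thesis
    unfolding Z_hat_def by (simp add: integral_first_letter[OF sets])
qed

section \<open>\<open>Phi_inverse\<close> as normalized restriction to the base\<close>

lemma sets_Phi_inverse [simp]: "sets (Phi_inverse w \<nu>) = sets config_space"
  by (simp add: Phi_inverse_def)

lemma emeasure_first_letter:
  assumes sets: "sets \<nu> = sets config_space" and A: "A \<in> sets config_space"
  shows "(\<integral>\<^sup>+s. emeasure \<nu> (\<phi> ` (A \<inter> Yhat_sub s)) \<partial>count_space UNIV) = emeasure \<nu> (\<phi> ` A)"
proof -
  have "disjoint_family (\<lambda>s. \<phi> ` (A \<inter> Yhat_sub s))"
    using Yhat_sub_disjoint[of A UNIV] unfolding disjoint_family_on_def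
    by (simp add: image_Int[OF inj_subst_map, symmetric])
  then have "(\<integral>\<^sup>+s. emeasure \<nu> (\<phi> ` (A \<inter> Yhat_sub s)) \<partial>count_space UNIV) = emeasure \<nu> (\<Union>s. \<phi> ` (A \<inter> Yhat_sub s))"
    by (intro emeasure_UN_countable[symmetric]) (auto simp: sets intro!: subst_map_image_sets A)
  also have "(\<Union>s. \<phi> ` (A \<inter> Yhat_sub s)) = \<phi> ` A"
    by (auto simp: Yhat_sub_def)
  finally show ?thesis .
qed

lemma Z_tilde_eq:
  assumes sets: "sets \<nu> = sets config_space"
  shows "Z_tilde w \<nu> = emeasure \<nu> (range \<phi>)"
  using emeasure_first_letter[OF sets, of UNIV] by (simp add: Z_tilde_def Y_sub_def)

lemma emeasure_Phi_inverse:
  assumes sets: "sets \<nu> = sets config_space" and A: "A \<in> sets config_space"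
  shows "emeasure (Phi_inverse w \<nu>) A = inverse (emeasure \<nu> (range \<phi>)) * emeasure \<nu> (\<phi> ` A)"
proof -
  have space: "space \<nu> = UNIV"
    using sets_eq_imp_space_eq[OF sets] by simp
  have Y_sub: "Y_sub w s \<in> sets config_space" for s
    unfolding Y_sub_def by (intro subst_map_image_sets Yhat_sub_sets)
  have "emeasure (distr (restrict_space \<nu> (Y_sub w s)) config_space (inv_into (Yhat_sub s) (phi_shift w 0))) A =
      emeasure \<nu> (\<phi> ` (A \<inter> Yhat_sub s))" for s
  proof -
    let ?g = "inv_into (Yhat_sub s) (phi_shift w 0)"
    have phi0: "phi_shift w 0 = \<phi>"
      by (simp add: phi_shift_def translate_0)
    \<comment> \<open>On \<open>Y_sub w s\<close> the function \<open>?g\<close> inverts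
      \<open>\<phi>\<close>, so its preimages are images under \<open>\<phi>\<close>, measurable by
      Lusin-Souslin. Elsewhere \<open>inv_into\<close> is unspecified, hence the
      intersection.\<close>
    have g: "?g -` B \<inter> Y_sub w s = \<phi> ` (B \<inter> Yhat_sub s)" for B
      unfolding Y_sub_def phi0 using inj_on_subset[OF inj_subst_map subset_UNIV] by (auto simp: inv_into_f_f)
    have "?g \<in> measurable (restrict_space \<nu> (Y_sub w s)) config_space"
    proof (rule measurableI)
      fix B :: "(int \<Rightarrow> 's) set" assume B: "B \<in> sets config_space"
      have "\<phi> ` (B \<inter> Yhat_sub s) = Y_sub w s \<inter> \<phi> ` (B \<inter> Yhat_sub s)"
        by (auto simp: Y_sub_def)
      moreover have "\<phi> ` (B \<inter> Yhat_sub s) \<in> sets config_space"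
        by (intro subst_map_image_sets sets.Int Yhat_sub_sets B)
      ultimately show "?g -` B \<inter> space (restrict_space \<nu> (Y_sub w s)) \<in> sets (restrict_space \<nu> (Y_sub w s))"
        by (auto simp: space_restrict_space space g sets_restrict_space sets)
    qed simp
    from emeasure_distr[OF this A] show ?thesis
      using Y_sub by (simp add: space_restrict_space space g) (subst emeasure_restrict_space; auto simp: Y_sub_def sets)
  qed
  then show ?thesis
    by (simp add: Phi_inverse_def emeasure_scale_measure emeasure_sum_measure A Z_tilde_eq[OF sets]
        emeasure_first_letter[OF assms])
qed

section \<open>\<open>Phi\<close> takes values in the regular measures\<close>

abbreviation covered :: "(int \<Rightarrow> 't) set" where
  "covered \<equiv> \<Union>s. \<Union>j<length (w s). Y_shift w s j"

lemma covered_sets: "covered \<in> sets config_space"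
  by (intro sets.countable_UN' image_subsetI Y_shift_sets) auto

lemma translate_subst_map_covered: "j < len \<zeta> \<Longrightarrow> translate (- int j) (\<phi> \<zeta>) \<in> covered"
  unfolding Y_shift_eq by (auto simp: Yhat_sub_def intro!: exI[of _ "\<zeta> 1"] bexI[of _ j] imageI)

text \<open>Words have at least one letter, so the mean length is at least 1. This excludes the
  degenerate factor \<open>inverse 0\<close>, which is infinite.\<close>

lemma Z_hat_nonzero:
  assumes "TI_prob \<mu>"
  shows "Z_hat w \<mu> \<noteq> 0"
proof -
  have "1 = (\<integral>\<^sup>+\<zeta>. 1 \<partial>\<mu>)"
    using TI_prob_UNIV[OF assms] by (simp add: TI_prob_space[OF assms])
  also have "\<dots> \<le> (\<integral>\<^sup>+\<zeta>. of_nat (len \<zeta>) \<partial>\<mu>)"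
  proof (rule nn_integral_mono)
    show "(1::ennreal) \<le> of_nat (len \<zeta>)" for \<zeta>
      using len_pos[of \<zeta>] by (metis One_nat_def Suc_leI of_nat_1 of_nat_mono)
  qed
  finally show ?thesis
    unfolding Z_hat_eq[OF TI_prob_sets[OF assms]] by (metis not_one_le_zero)
qed

lemma emeasure_Phi_UNIV:
  assumes "\<mu> \<in> M_hat w"
  shows "emeasure (Phi w \<mu>) UNIV = 1"
proof -
  have TI: "TI_prob \<mu>" and "Z_hat w \<mu> < \<infinity>"
    using assms by (auto simp: M_hat_def)
  have "emeasure (Phi w \<mu>) UNIV = inverse (Z_hat w \<mu>) * Z_hat w \<mu>"
    by (simp add: emeasure_Phi Z_hat_eq TI_prob_sets[OF TI] visits_def)
  then show ?thesis
    using Z_hat_nonzero[OF TI] \<open>Z_hat w \<mu> < \<infinity>\<close>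
    by (simp add: ennreal_inverse_mult_self)
qed

text \<open>Along a block the two counts differ by an entry and an exit term, and the exit term is the entry term
  of the next block.\<close>

lemma visits_translate:
  "visits (translate (- 1) -` A) \<zeta> + indicator A (\<phi> \<zeta>) = visits A \<zeta> + indicator A (\<phi> (translate (- 1) \<zeta>))"
proof -
  let ?f = "\<lambda>j. indicator A (translate (- int j) (\<phi> \<zeta>)) :: ennreal"
  have "visits (translate (- 1) -` A) \<zeta> = (\<Sum>j<len \<zeta>. ?f (Suc j))"
    unfolding visits_def by (intro sum.cong) (auto simp: indicator_def translate_translate)
  moreover have "?f 0 + (\<Sum>j<len \<zeta>. ?f (Suc j)) = (\<Sum>j<len \<zeta>. ?f j) + ?f (len \<zeta>)"
    by (rule trans[OF sum.lessThan_Suc_shift[symmetric] sum.lessThan_Suc])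
  ultimately show ?thesis
    by (simp add: visits_def translate_0 subst_map_translate_left add.commute)
qed

lemma Phi_in_M_reg:
  assumes "\<mu> \<in> M_hat w"
  shows "Phi w \<mu> \<in> M_reg w"
proof -
  have TI: "TI_prob \<mu>"
    using assms by (auto simp: M_hat_def)
  note sets = TI_prob_sets[OF TI]
  have meas: "f \<in> borel_measurable \<mu>" if "f \<in> borel_measurable config_space" for f :: "(int \<Rightarrow> 's) \<Rightarrow> ennreal"
    using that measurable_cong_sets[OF sets refl] by blast
  have ind: "(\<lambda>\<zeta>. indicator A (translate n (\<phi> \<zeta>))) = indicator (\<phi> -` translate n -` A)" for A n
    by (auto simp: indicator_def)
  have inv: "emeasure (Phi w \<mu>) (translate (- 1) -` A) = emeasure (Phi w \<mu>) A" if A: "A \<in> sets config_space" for A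
  proof -
    let ?B = "\<phi> -` A"
    have B: "?B \<in> sets config_space"
      using A by (rule subst_map_vimage_sets)
    \<comment> \<open>The entry and exit terms stand on opposite sides to avoid subtraction in
      \<open>ennreal\<close>; invariance of \<open>\<mu>\<close> makes their integrals equal, and
      finiteness lets them cancel.\<close>
    have "(\<integral>\<^sup>+\<zeta>. visits (translate (- 1) -` A) \<zeta> \<partial>\<mu>) + emeasure \<mu> ?B =
        (\<integral>\<^sup>+\<zeta>. visits (translate (- 1) -` A) \<zeta> + indicator ?B \<zeta> \<partial>\<mu>)"
      by (subst nn_integral_add) (use meas visits_measurable[OF translate_vimage_sets[OF A]] B sets in auto)
    also have "\<dots> = (\<integral>\<^sup>+\<zeta>. visits A \<zeta> + indicator (translate (- 1) -` ?B) \<zeta> \<partial>\<mu>)"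
      by (intro nn_integral_cong) (use visits_translate[of A] in \<open>simp add: indicator_def\<close>)
    also have "\<dots> = (\<integral>\<^sup>+\<zeta>. visits A \<zeta> \<partial>\<mu>) + emeasure \<mu> (translate (- 1) -` ?B)"
      by (subst nn_integral_add) (use meas visits_measurable[OF A] translate_vimage_sets[OF B] sets in auto)
    finally have "emeasure \<mu> ?B + (\<integral>\<^sup>+\<zeta>. visits (translate (- 1) -` A) \<zeta> \<partial>\<mu>) =
        emeasure \<mu> ?B + (\<integral>\<^sup>+\<zeta>. visits A \<zeta> \<partial>\<mu>)"
      by (simp add: TI_prob_emeasure_vimage[OF TI B] add.commute)
    moreover have "emeasure \<mu> ?B \<noteq> \<infinity>"
      by (rule TI_prob_finite[OF TI])
    ultimately show ?thesis
      by (simp add: ennreal_add_left_cancel emeasure_Phi[OF sets] A translate_vimage_sets)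
  qed
  have "TI_prob (Phi w \<mu>)"
  proof (rule TI_probI)
    fix A :: "(int \<Rightarrow> 't) set" assume "A \<in> sets config_space"
    \<comment> \<open>\<open>inv\<close> concerns \<open>translate (- 1)\<close>, which climbs the
      tower; applied to a preimage under \<open>translate 1\<close> it yields the direction in
      \<open>TI_prob\<close>.\<close>
    from inv[OF translate_vimage_sets[OF this, of 1]]
    show "emeasure (Phi w \<mu>) (translate 1 -` A) = emeasure (Phi w \<mu>) A"
      by (simp add: vimage_def translate_translate translate_0)
  qed (use emeasure_Phi_UNIV[OF assms] in simp_all)
  moreover have "AE \<eta> in Phi w \<mu>. \<eta> \<in> covered"
  proof (rule AE_I)
    have "visits (- covered) \<zeta> = 0" for \<zeta>
      unfolding visits_def by (intro sum.neutral) (use translate_subst_map_covered in \<open>auto simp: indicator_def\<close>)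
    moreover have "- covered \<in> sets config_space"
      using sets.compl_sets[OF covered_sets] by (simp add: Compl_eq_Diff_UNIV)
    ultimately show "emeasure (Phi w \<mu>) (- covered) = 0" "- covered \<in> sets (Phi w \<mu>)"
      by (simp_all add: emeasure_Phi[OF sets])
  qed auto
  ultimately show ?thesis
    by (simp add: M_reg_def)
qed

text \<open>Positions are unique, so no level above 0 is a base point. Hence on the base
  \<open>Phi w \<mu>\<close> is the image of \<open>\<mu>\<close> divided by
  \<open>Z_hat w \<mu>\<close>.\<close>

lemma visits_image: "visits (\<phi> ` A) = indicator A"
proof
  fix \<zeta>
  have "translate (- int j) (\<phi> \<zeta>) \<in> \<phi> ` A \<longleftrightarrow> j = 0 \<and> \<zeta> \<in> A" if j: "j < len \<zeta>" for j
  proof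
    assume "translate (- int j) (\<phi> \<zeta>) \<in> \<phi> ` A"
    then obtain \<xi> where \<xi>: "\<xi> \<in> A" "translate (- int j) (\<phi> \<zeta>) = \<phi> \<xi>"
      by blast
    then show "j = 0 \<and> \<zeta> \<in> A"
      using position_determined[of j \<zeta> 0 \<xi>] j len_pos by (simp add: translate_0)
  qed (simp add: translate_0)
  then have "visits (\<phi> ` A) \<zeta> = (\<Sum>j<len \<zeta>. if j = 0 then indicator A \<zeta> else 0)"
    unfolding visits_def by (intro sum.cong) (auto simp: indicator_def)
  then show "visits (\<phi> ` A) \<zeta> = indicator A \<zeta>"
    using len_pos by (simp add: sum.delta)
qed

lemma Phi_inverse_Phi:
  assumes "\<mu> \<in> M_hat w"
  shows "Phi_inverse w (Phi w \<mu>) = \<mu>"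
proof (rule measure_eqI)
  have TI: "TI_prob \<mu>" and Z: "Z_hat w \<mu> < \<infinity>"
    using assms by (auto simp: M_hat_def)
  note sets = TI_prob_sets[OF TI]
  show "sets (Phi_inverse w (Phi w \<mu>)) = sets \<mu>"
    by (simp add: sets)
  have image: "emeasure (Phi w \<mu>) (\<phi> ` A) = inverse (Z_hat w \<mu>) * emeasure \<mu> A" if "A \<in> sets config_space" for A
    using that by (simp add: emeasure_Phi[OF sets] subst_map_image_sets visits_image sets)
  fix A assume "A \<in> sets (Phi_inverse w (Phi w \<mu>))"
  then have A: "A \<in> sets config_space"
    by simp
  \<comment> \<open>The base has measure \<open>inverse (Z_hat w \<mu>)\<close>, and
    \<open>Phi_inverse\<close> divides by it.\<close>
  have "inverse (inverse (Z_hat w \<mu>)) * (inverse (Z_hat w \<mu>) * emeasure \<mu> A) = emeasure \<mu> A"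
    using Z Z_hat_nonzero[OF TI]
    by (simp add: mult.assoc[symmetric] ennreal_inverse_mult_self)
  then show "emeasure (Phi_inverse w (Phi w \<mu>)) A = emeasure \<mu> A"
    using A by (simp add: emeasure_Phi_inverse image TI_prob_UNIV[OF TI])
qed

section \<open>Kac's formula and the measure on the base\<close>

lemma emeasure_blocks:
  assumes TI: "TI_prob \<nu>" and A: "A \<in> sets config_space"
  shows "(\<integral>\<^sup>+s. (\<Sum>j<length (w s). emeasure \<nu> (\<phi> ` (phi_shift w j -` A \<inter> Yhat_sub s))) \<partial>count_space UNIV) =
    emeasure \<nu> (covered \<inter> A)"
proof -
  note sets = TI_prob_sets[OF TI]
  \<comment> \<open>Invariance lifts a piece of the base to level \<open>j\<close> at equal measure,
    where it becomes the part of \<open>A\<close> in \<open>Y_shift w s j\<close>. What remains is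
    to add up disjoint levels.\<close>
  have "emeasure \<nu> (\<phi> ` (phi_shift w j -` A \<inter> Yhat_sub s)) = emeasure \<nu> (Y_shift w s j \<inter> A)" for s j
  proof -
    have "phi_shift w j -` A \<inter> Yhat_sub s \<in> sets config_space"
      unfolding phi_shift_def vimage_comp[symmetric]
      by (intro sets.Int Yhat_sub_sets subst_map_vimage_sets translate_vimage_sets A)
    moreover have "Y_shift w s j \<inter> A = translate (- int j) ` \<phi> ` (phi_shift w j -` A \<inter> Yhat_sub s)"
      by (auto simp: Y_shift_eq phi_shift_def)
    ultimately show ?thesis
      by (simp add: TI_prob_emeasure_image[OF TI subst_map_image_sets])
  qed
  moreover have "(\<Sum>j<length (w s). emeasure \<nu> (Y_shift w s j \<inter> A)) = emeasure \<nu> (\<Union>j<length (w s). Y_shift w s j \<inter> A)" for s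
  proof (rule sum_emeasure)
    show "disjoint_family_on (\<lambda>j. Y_shift w s j \<inter> A) {..<length (w s)}"
      unfolding disjoint_family_on_def
    proof (intro ballI impI)
      fix j k assume "j \<in> {..<length (w s)}" "k \<in> {..<length (w s)}" "j \<noteq> k"
      then show "(Y_shift w s j \<inter> A) \<inter> (Y_shift w s k \<inter> A) = {}"
        using disjoint_family_onD[OF Y_shift_disjoint, of "(s, j)" "(s, k)"] by auto
    qed
  qed (use Y_shift_sets A sets in auto)
  moreover have "(\<integral>\<^sup>+s. emeasure \<nu> (\<Union>j<length (w s). Y_shift w s j \<inter> A) \<partial>count_space UNIV) =
      emeasure \<nu> (\<Union>s. \<Union>j<length (w s). Y_shift w s j \<inter> A)"
  proof (rule emeasure_UN_countable[symmetric])
    show "disjoint_family (\<lambda>s. \<Union>j<length (w s). Y_shift w s j \<inter> A)"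
      unfolding disjoint_family_on_def
    proof (intro ballI impI)
      fix s t :: 's assume "s \<noteq> t"
      then have "Y_shift w s j \<inter> Y_shift w t k = {}" if "j < length (w s)" "k < length (w t)" for j k
        using disjoint_family_onD[OF Y_shift_disjoint, of "(s, j)" "(t, k)"] that by auto
      then show "(\<Union>j<length (w s). Y_shift w s j \<inter> A) \<inter> (\<Union>j<length (w t). Y_shift w t j \<inter> A) = {}"
        by blast
    qed
  qed (use Y_shift_sets A sets in auto)
  moreover have "(\<Union>s. \<Union>j<length (w s). Y_shift w s j \<inter> A) = covered \<inter> A"
    by auto
  ultimately show ?thesis
    by simp
qed

lemma emeasure_covered:
  assumes "\<nu> \<in> M_reg w" "A \<in> sets config_space"
  shows "emeasure \<nu> (covered \<inter> A) = emeasure \<nu> A"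
proof (rule emeasure_eq_AE)
  show "AE \<eta> in \<nu>. (\<eta> \<in> covered \<inter> A) = (\<eta> \<in> A)"
    using assms(1) unfolding M_reg_def by auto
qed (use assms covered_sets in \<open>auto simp: M_reg_def TI_prob_sets intro!: sets.Int\<close>)

text \<open>The third claim is Kac's formula: the levels over each \<open>Y_sub w s\<close> have
  equal measure and together carry all of \<open>\<nu>\<close>. A null base would make every level
  null.\<close>

lemma emeasure_range_subst_map:
  assumes "\<nu> \<in> M_reg w"
  shows "emeasure \<nu> (range \<phi>) \<noteq> 0" "emeasure \<nu> (range \<phi>) \<noteq> \<infinity>"
    and "(\<integral>\<^sup>+s. of_nat (length (w s)) * emeasure \<nu> (\<phi> ` Yhat_sub s) \<partial>count_space UNIV) = 1"
proof -
  have TI: "TI_prob \<nu>"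
    using assms by (simp add: M_reg_def)
  note sets = TI_prob_sets[OF TI]
  show total: "(\<integral>\<^sup>+s. of_nat (length (w s)) * emeasure \<nu> (\<phi> ` Yhat_sub s) \<partial>count_space UNIV) = 1"
    using emeasure_blocks[OF TI, of UNIV] emeasure_covered[OF assms, of UNIV] TI_prob_UNIV[OF TI] by simp
  show "emeasure \<nu> (range \<phi>) \<noteq> \<infinity>"
    by (rule TI_prob_finite[OF TI])
  show "emeasure \<nu> (range \<phi>) \<noteq> 0"
  proof
    assume "emeasure \<nu> (range \<phi>) = 0"
    moreover have "range \<phi> \<in> sets \<nu>"
      unfolding sets by (rule subst_map_image_sets) simp
    ultimately have "emeasure \<nu> (\<phi> ` Yhat_sub s) = 0" for s
      by (metis emeasure_eq_0 image_mono subset_UNIV)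
    then show False
      using total by simp
  qed
qed

text \<open>Under \<open>\<phi>\<close>, \<open>translate (- 1)\<close> becomes the first return map
  of the base, which on the piece of letter \<open>s\<close> is translation by
  \<open>- int (length (w s))\<close>. So invariance is checked piece by piece. The value of
  \<open>Z_hat\<close> is Kac's formula divided by the measure of the base.\<close>

lemma Phi_inverse_in_M_hat:
  assumes "\<nu> \<in> M_reg w"
  shows "Phi_inverse w \<nu> \<in> M_hat w" "Z_hat w (Phi_inverse w \<nu>) = inverse (emeasure \<nu> (range \<phi>))"
proof -
  have TI: "TI_prob \<nu>"
    using assms by (simp add: M_reg_def)
  note sets = TI_prob_sets[OF TI]
  have "TI_prob (Phi_inverse w \<nu>)"
  proof (rule TI_probI)
    show "emeasure (Phi_inverse w \<nu>) UNIV = 1"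
      using emeasure_range_subst_map[OF assms]
      by (simp add: emeasure_Phi_inverse sets ennreal_inverse_mult_self)
    fix A :: "(int \<Rightarrow> 's) set" assume A: "A \<in> sets config_space"
    let ?B = "translate 1 -` A"
    have "?B = translate (- 1) ` A"
      by (simp add: translate_image)
    have B_eq: "\<phi> ` ?B = (\<Union>s. \<phi> ` translate (- 1) ` (A \<inter> Yhat_sub s))"
      unfolding \<open>?B = _\<close> by (auto simp: Yhat_sub_def)
    have piece: "\<phi> ` translate (- 1) ` (A \<inter> Yhat_sub s) = translate (- int (length (w s))) ` \<phi> ` (A \<inter> Yhat_sub s)" for s
      unfolding image_image by (intro image_cong refl) (auto simp: subst_map_translate_left Yhat_sub_def)
    have piece_sets: "\<phi> ` translate (- 1) ` (A \<inter> Yhat_sub s) \<in> sets \<nu>" for s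
      unfolding sets piece translate_image
      by (intro translate_vimage_sets subst_map_image_sets sets.Int A Yhat_sub_sets)
    have "disjoint_family (\<lambda>s. \<phi> ` translate (- 1) ` (A \<inter> Yhat_sub s))"
      using Yhat_sub_disjoint[of A UNIV] unfolding disjoint_family_on_def
      by (simp add: image_Int[OF inj_subst_map, symmetric] image_Int[OF inj_translate, symmetric])
    then have "emeasure \<nu> (\<phi> ` ?B) = (\<integral>\<^sup>+s. emeasure \<nu> (\<phi> ` translate (- 1) ` (A \<inter> Yhat_sub s)) \<partial>count_space UNIV)"
      unfolding B_eq by (intro emeasure_UN_countable) (use piece_sets in auto)
    also have "\<dots> = (\<integral>\<^sup>+s. emeasure \<nu> (\<phi> ` (A \<inter> Yhat_sub s)) \<partial>count_space UNIV)"
      unfolding piece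
      by (intro nn_integral_cong TI_prob_emeasure_image[OF TI] subst_map_image_sets sets.Int A Yhat_sub_sets)
    also have "\<dots> = emeasure \<nu> (\<phi> ` A)"
      by (rule emeasure_first_letter[OF sets A])
    finally show "emeasure (Phi_inverse w \<nu>) ?B = emeasure (Phi_inverse w \<nu>) A"
      by (simp add: emeasure_Phi_inverse sets A translate_vimage_sets)
  qed simp
  moreover show Z: "Z_hat w (Phi_inverse w \<nu>) = inverse (emeasure \<nu> (range \<phi>))"
  proof -
    have "Z_hat w (Phi_inverse w \<nu>) = (\<integral>\<^sup>+s. inverse (emeasure \<nu> (range \<phi>)) *
        (of_nat (length (w s)) * emeasure \<nu> (\<phi> ` Yhat_sub s)) \<partial>count_space UNIV)"
      unfolding Z_hat_def by (intro nn_integral_cong) (simp add: emeasure_Phi_inverse sets ac_simps)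
    then show ?thesis
      by (simp add: nn_integral_cmult emeasure_range_subst_map(3)[OF assms])
  qed
  ultimately show "Phi_inverse w \<nu> \<in> M_hat w"
    using emeasure_range_subst_map(1)[OF assms] by (simp add: M_hat_def less_top[symmetric])
qed

lemma Phi_Phi_inverse:
  assumes "\<nu> \<in> M_reg w"
  shows "Phi w (Phi_inverse w \<nu>) = \<nu>"
proof (rule measure_eqI)
  have TI: "TI_prob \<nu>"
    using assms by (simp add: M_reg_def)
  note sets = TI_prob_sets[OF TI]
  let ?c = "emeasure \<nu> (range \<phi>)"
  show "sets (Phi w (Phi_inverse w \<nu>)) = sets \<nu>"
    by (simp add: sets)
  fix A assume "A \<in> sets (Phi w (Phi_inverse w \<nu>))"
  then have A: "A \<in> sets config_space"
    by simp
  have pre: "phi_shift w j -` A \<inter> Yhat_sub s \<in> sets config_space" for s j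
    unfolding phi_shift_def vimage_comp[symmetric]
    by (intro sets.Int Yhat_sub_sets subst_map_vimage_sets translate_vimage_sets A)
  \<comment> \<open>The form of \<open>Phi\<close> as a sum fits here, because
    \<open>Phi_inverse\<close> is known by its values on sets and the result is the sum in
    \<open>emeasure_blocks\<close>.\<close>
  have "emeasure (Phi w (Phi_inverse w \<nu>)) A = inverse (inverse ?c) * (inverse ?c * emeasure \<nu> (covered \<inter> A))"
    by (simp add: emeasure_Phi_sum A emeasure_Phi_inverse sets pre Phi_inverse_in_M_hat(2)[OF assms]
        sum_distrib_left[symmetric] nn_integral_cmult emeasure_blocks[OF TI A])
  also have "\<dots> = emeasure \<nu> (covered \<inter> A)"
    using emeasure_range_subst_map(1,2)[OF assms]
    by (simp add: mult.assoc[symmetric] ennreal_inverse_mult_self)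
  finally show "emeasure (Phi w (Phi_inverse w \<nu>)) A = emeasure \<nu> A"
    by (simp add: emeasure_covered[OF assms A])
qed

section \<open>Invariant sets and ergodicity\<close>

lemma translate_vimage_invariant:
  assumes "translate 1 -` A = A"
  shows "translate n \<eta> \<in> A \<longleftrightarrow> \<eta> \<in> A"
proof (induction n rule: int_induct[where k = 0])
  case base
  show ?case by (simp add: translate_0)
next
  case (step1 n)
  have "translate 1 (translate n \<eta>) \<in> A \<longleftrightarrow> translate n \<eta> \<in> A"
    using assms by blast
  then show ?case
    using step1 by (simp add: translate_translate add.commute)
next
  case (step2 n)
  have "translate 1 (translate (n - 1) \<eta>) \<in> A \<longleftrightarrow> translate (n - 1) \<eta> \<in> A"
    using assms by blast
  then show ?case
    using step2 by (simp add: translate_translate)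
qed

text \<open>For invariant \<open>A\<close> the count is either 0 or the positive number
  \<open>len \<zeta>\<close>, so its integral vanishes exactly if \<open>\<phi> \<zeta>\<close>
  almost surely avoids \<open>A\<close>. Finiteness of \<open>Z_hat\<close> keeps the factor in
  front from being 0.\<close>

lemma Phi_null_iff:
  assumes "\<mu> \<in> M_hat w" and A: "A \<in> sets config_space" and inv: "translate 1 -` A = A"
  shows "emeasure (Phi w \<mu>) A = 0 \<longleftrightarrow> emeasure \<mu> (\<phi> -` A) = 0"
proof -
  have TI: "TI_prob \<mu>" and Z: "Z_hat w \<mu> < \<infinity>"
    using assms by (auto simp: M_hat_def)
  note sets = TI_prob_sets[OF TI]
  have B: "\<phi> -` A \<in> sets \<mu>"
    unfolding sets by (rule subst_map_vimage_sets[OF A])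
  have visits_0: "visits A \<zeta> = 0 \<longleftrightarrow> \<zeta> \<notin> \<phi> -` A" for \<zeta>
  proof -
    have "visits A \<zeta> = of_nat (len \<zeta>) * indicator A (\<phi> \<zeta>)"
      unfolding visits_def by (simp add: indicator_def translate_vimage_invariant[OF inv])
    then show ?thesis
      using len_pos[of \<zeta>] by (auto simp: indicator_def)
  qed
  have "visits A \<in> borel_measurable \<mu>"
    using visits_measurable[OF A] measurable_cong_sets[OF sets refl] by blast
  then have "(\<integral>\<^sup>+\<zeta>. visits A \<zeta> \<partial>\<mu>) = 0 \<longleftrightarrow> (AE \<zeta> in \<mu>. \<zeta> \<notin> \<phi> -` A)"
    by (simp add: nn_integral_0_iff_AE visits_0)
  also have "\<dots> \<longleftrightarrow> emeasure \<mu> (\<phi> -` A) = 0"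
    by (subst AE_iff_measurable[OF B]) (auto simp: TI_prob_space[OF TI])
  finally show ?thesis
    using Z by (auto simp: emeasure_Phi[OF sets A])
qed

lemma ergodic_Phi_iff:
  assumes "\<mu> \<in> M_hat w"
  shows "ergodic (Phi w \<mu>) \<longleftrightarrow> ergodic \<mu>"
proof -
  have TI: "TI_prob \<mu>"
    using assms by (auto simp: M_hat_def)
  have TI': "TI_prob (Phi w \<mu>)"
    using Phi_in_M_reg[OF assms] by (simp add: M_reg_def)
  have compl: "- A \<in> sets config_space" if "A \<in> sets config_space" for A :: "(int \<Rightarrow> 'a) set"
    using sets.compl_sets[OF that] by (simp add: Compl_eq_Diff_UNIV)
  show ?thesis
    unfolding ergodic_iff_null[OF TI] ergodic_iff_null[OF TI']
  proof (intro iffI ballI impI)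
    fix B :: "(int \<Rightarrow> 's) set"
    assume erg: "\<forall>A\<in>sets config_space. translate 1 -` A = A \<longrightarrow> emeasure (Phi w \<mu>) A = 0 \<or> emeasure (Phi w \<mu>) (- A) = 0"
      and B: "B \<in> sets config_space" and inv: "translate 1 -` B = B"
    \<comment> \<open>The saturation of the image of \<open>B\<close> under the countably many
      translations.\<close>
    define A where "A = (\<Union>n. translate n -` \<phi> ` B)"
    have A: "A \<in> sets config_space"
      unfolding A_def
      by (intro sets.countable_UN' image_subsetI translate_vimage_sets subst_map_image_sets B) auto
    have A_inv: "translate 1 -` A = A"
    proof -
      have "translate 1 \<eta> \<in> A \<longleftrightarrow> \<eta> \<in> A" for \<eta>
      proof -
        have "translate 1 \<eta> \<in> A \<longleftrightarrow> (\<exists>n. translate (n + 1) \<eta> \<in> \<phi> ` B)"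
          by (simp add: A_def translate_translate)
        also have "\<dots> \<longleftrightarrow> (\<exists>n. translate n \<eta> \<in> \<phi> ` B)"
          by (metis diff_add_cancel)
        finally show ?thesis
          by (simp add: A_def)
      qed
      then show ?thesis
        by auto
    qed
    have "\<phi> -` A = B"
    proof (intro equalityI subsetI)
      fix \<zeta> assume "\<zeta> \<in> \<phi> -` A"
      then obtain n \<xi> where \<xi>: "\<xi> \<in> B" "translate n (\<phi> \<zeta>) = \<phi> \<xi>"
        by (auto simp: A_def)
      \<comment> \<open>The translate is level \<open>j\<close> over a shift of
        \<open>\<zeta>\<close> and also level 0 over \<open>\<xi>\<close>. Uniqueness of positions
        identifies that shift with \<open>\<xi>\<close>, and invariance of \<open>B\<close> leads
        back to \<open>\<zeta>\<close>.\<close>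
      obtain m j where m: "j < len (translate (- m) \<zeta>)"
        "translate (- (- n)) (\<phi> \<zeta>) = translate (- int j) (\<phi> (translate (- m) \<zeta>))"
        by (rule translate_subst_map)
      have "translate (- m) \<zeta> = \<xi>"
        using position_determined(1)[of j "translate (- m) \<zeta>" 0 \<xi>] len_pos m \<xi>(2) by (simp add: translate_0)
      then show "\<zeta> \<in> B"
        using \<xi>(1) translate_vimage_invariant[OF inv, of "- m" \<zeta>] by simp
    next
      fix \<zeta> assume "\<zeta> \<in> B"
      then show "\<zeta> \<in> \<phi> -` A"
        unfolding A_def by (auto intro!: exI[of _ 0] simp: translate_0)
    qed
    moreover have "emeasure (Phi w \<mu>) A = 0 \<or> emeasure (Phi w \<mu>) (- A) = 0"
      using erg A A_inv by blast
    moreover have "translate 1 -` (- A) = - A"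
      using A_inv by blast
    ultimately show "emeasure \<mu> B = 0 \<or> emeasure \<mu> (- B) = 0"
      using Phi_null_iff[OF assms A A_inv] Phi_null_iff[OF assms compl[OF A]] by (simp add: vimage_Compl)
  next
    fix A :: "(int \<Rightarrow> 't) set"
    assume erg: "\<forall>B\<in>sets config_space. translate 1 -` B = B \<longrightarrow> emeasure \<mu> B = 0 \<or> emeasure \<mu> (- B) = 0"
      and A: "A \<in> sets config_space" and inv: "translate 1 -` A = A"
    \<comment> \<open>\<open>\<phi> (translate 1 \<zeta>)\<close> is a translate of
      \<open>\<phi> \<zeta>\<close> by an amount depending on \<open>\<zeta>\<close>, which
      invariance of \<open>A\<close> under all powers absorbs.\<close>
    have "translate 1 -` \<phi> -` A = \<phi> -` A"
      using translate_vimage_invariant[OF inv] by (auto simp: subst_map_translate_right)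
    then have "emeasure \<mu> (\<phi> -` A) = 0 \<or> emeasure \<mu> (- (\<phi> -` A)) = 0"
      using erg subst_map_vimage_sets[OF A] by blast
    moreover have "translate 1 -` (- A) = - A"
      using inv by blast
    ultimately show "emeasure (Phi w \<mu>) A = 0 \<or> emeasure (Phi w \<mu>) (- A) = 0"
      using Phi_null_iff[OF assms A inv] Phi_null_iff[OF assms compl[OF A]] by (simp add: vimage_Compl)
  qed
qed

end

theorem theoremA1:
  fixes w :: "'s::countable \<Rightarrow> 't::countable list"
  assumes "\<And>s. w s \<noteq> []"
    and "disjoint_family_on (\<lambda>(s, j). Y_shift w s j) (SIGMA s:UNIV. {..<length (w s)})"
  shows "bij_betw (Phi w) (M_hat w) (M_reg w) \<and>
    (\<forall>\<nu>\<in>M_reg w. inv_into (M_hat w) (Phi w) \<nu> = Phi_inverse w \<nu>) \<and>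
    (\<forall>\<nu>\<in>M_hat w. ergodic (Phi w \<nu>) \<longleftrightarrow> ergodic \<nu>)"
proof -
  interpret substitution w
    by standard (fact assms)+
  have bij: "bij_betw (Phi w) (M_hat w) (M_reg w)"
    by (rule bij_betw_byWitness[where f' = "Phi_inverse w"])
       (use Phi_inverse_Phi Phi_Phi_inverse Phi_in_M_reg Phi_inverse_in_M_hat(1) in auto)
  moreover have "inv_into (M_hat w) (Phi w) \<nu> = Phi_inverse w \<nu>" if "\<nu> \<in> M_reg w" for \<nu>
    using bij_betw_imp_inj_on[OF bij] Phi_inverse_in_M_hat(1)[OF that] Phi_Phi_inverse[OF that]
    by (rule inv_into_f_eq)
  ultimately show ?thesis
    using ergodic_Phi_iff by blast
qed

end
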